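(* Let $\mu\in\mathbb R$, $\alpha>0$. Then, as $\alpha\to\infty$, the following asymptotics hold: for the monodromy matrix, $$e^{-\alpha a}\,M(\mu+i\alpha)=\frac12\,e^{i(Q(a)-\mu a)}(\mathbb I-\sigma_2)+O\left(\tfrac1\alpha\right);$$ for the discriminant, $$e^{-\alpha a}\,\mathfrak D(\mu+i\alpha)=e^{i(Q(a)-\mu a)}+O\left(\tfrac1\alpha\right);$$ for the quasimomentum (with the free additive constant in $\frac{2\pi}a\mathbb Z$ in its definition suitably chosen, independently of $\mu$ and $\alpha$), $$k(\mu+i\alpha)=\mu+i\alpha-\frac{Q(a)}a+O\left(\tfrac1\alpha\right);$$ and for the (suitably normalised) eigenvectors of $M(\mu+i\alpha)$, $$v_+(\mu+i\alpha)=\begin{pmatrix}1\\-i\end{pmatrix}+O\left(\tfrac1\alpha\right),\qquad v_-(\mu+i\alpha)=\begin{pmatrix}1\\i\end{pmatrix}+O\left(\tfrac1\alpha\right).$$ Consequently, $$\Gamma(M(\mu+i\alpha))=1+O\left(\tfrac1\alpha\right).$$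
   Context: Setting: $m\ge0$, $a>0$, and $q:\mathbb R\to\mathbb R$ is locally integrable and $a$-periodic; $Q(x)=\int_0^xq$. Pauli matrices: $\sigma_2=\begin{pmatrix}0&-i\\i&0\end{pmatrix}$, $\sigma_3=\begin{pmatrix}1&0\\0&-1\end{pmatrix}$; $\mathbb I$ is the $2\times2$ unit matrix; $|w|=\sqrt{|w_1|^2+|w_2|^2}$ for $w\in\mathbb C^2$. For $\lambda\in\mathbb C$, $\Phi(\cdot,\lambda)$ is the $2\times2$ matrix solution of $-i\sigma_2\Phi'+(m\sigma_3+q)\Phi=\lambda\Phi$ on $\mathbb R$, $\Phi(0,\lambda)=\mathbb I$. The monodromy matrix is $M(\lambda)=\Phi(a,\lambda)$ (of determinant 1), the discriminant is $\mathfrak D(\lambda)=\operatorname{Tr}M(\lambda)$; $\mathfrak D(\lambda)\in[-2,2]$ only for real $\lambda$. Quasimomentum: on $\{\operatorname{Im}\lambda\ge0\}$, $k$ is a continuous function with $\mathfrak D(\lambda)=2\cos(k(\lambda)a)$ and $\operatorname{Im}k(\lambda)\ge0$ (determined up to an additive constant in $\frac{2\pi}a\mathbb Z$ on the open upper half-plane). If $\mathfrak D(\lambda)\notin[-2,2]$ and $\operatorname{Im}\lambda\ge0$, the eigenvalues of $M(\lambda)$ are $\rho(\lambda)=e^{-ik(\lambda)a}$ (outside the unit circle) and $1/\rho(\lambda)=e^{ik(\lambda)a}$ (inside the unit circle); $v_+(\lambda),v_-(\lambda)\in\mathbb C^2\setminus\{0\}$ denote corresponding eigenvectors, respectively, each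 unique up to a nonzero complex factor. For a matrix $A\in\mathbb C^{2\times2}$ with two distinct eigenvalues, $\Gamma(A)=\dfrac{|\det(w_+,w_-)|}{|w_+|\,|w_-|}\in(0,1]$, where $w_\pm\in\mathbb C^2\setminus\{0\}$ are eigenvectors of $A$ for the two different eigenvalues (independent of the choice of eigenvectors). *)

theory Defs
  imports "HOL-Analysis.Analysis" "HOL-Library.Landau_Symbols"
begin

definition \<sigma>2 :: "complex^2^2" where
  "\<sigma>2 = vector [vector [0, -\<i>], vector [\<i>, 0]]"

definition \<sigma>3 :: "complex^2^2" where
  "\<sigma>3 = vector [vector [1, 0], vector [0, -1]]"

definition cscale :: "complex \<Rightarrow> complex^2^2 \<Rightarrow> complex^2^2"  (infixr \<open>*\<^sub>M\<close> 75) where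
  "c *\<^sub>M A = (\<chi> i j. c * A $ i $ j)"

definition locally_integrable :: "(real \<Rightarrow> real) \<Rightarrow> bool" where
  "locally_integrable q \<longleftrightarrow> (\<forall>s t. q absolutely_integrable_on {s..t})"

definition potential_integral :: "(real \<Rightarrow> real) \<Rightarrow> real \<Rightarrow> real" where
  "potential_integral q x = (if 0 \<le> x then integral {0..x} q else - integral {x..0} q)"

text \<open>
  The usual \<open>\<epsilon>\<close>-\<open>\<delta>\<close> condition on every compact interval.  The members of \<open>d\<close> are
  finitely many compact intervals with disjoint interiors, \<open>K\<close> being \<open>{Inf K..Sup K}\<close>.
\<close>
definition locally_absolutely_continuous :: "(real \<Rightarrow> 'a::real_normed_vector) \<Rightarrow> bool" where
  "locally_absolutely_continuous f \<longleftrightarrow>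
     (\<forall>s t. \<forall>\<epsilon>>0. \<exists>\<delta>>0. \<forall>d. d division_of \<Union>d \<longrightarrow> \<Union>d \<subseteq> {s..t} \<longrightarrow>
        (\<Sum>K\<in>d. Sup K - Inf K) < \<delta> \<longrightarrow> (\<Sum>K\<in>d. norm (f (Sup K) - f (Inf K))) < \<epsilon>)"

text \<open>
  As \<open>q\<close> is only locally integrable, solutions are understood in the Caratheodory sense.
\<close>
definition dirac_solution ::
    "real \<Rightarrow> (real \<Rightarrow> real) \<Rightarrow> complex \<Rightarrow> (real \<Rightarrow> complex^2^2) \<Rightarrow> bool" where
  "dirac_solution m q z \<Psi> \<longleftrightarrow>
     locally_absolutely_continuous \<Psi> \<and>
     (AE x in lebesgue. \<exists>\<Psi>'. (\<Psi> has_vector_derivative \<Psi>') (at x) \<and>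
        (-\<i>) *\<^sub>M (\<sigma>2 ** \<Psi>') + (complex_of_real m *\<^sub>M \<sigma>3 + complex_of_real (q x) *\<^sub>M mat 1) ** \<Psi> x
          = z *\<^sub>M \<Psi> x)"

definition fundamental_solution ::
    "real \<Rightarrow> (real \<Rightarrow> real) \<Rightarrow> (real \<Rightarrow> complex \<Rightarrow> complex^2^2) \<Rightarrow> bool" where
  "fundamental_solution m q \<Phi> \<longleftrightarrow>
     (\<forall>z. dirac_solution m q z (\<lambda>x. \<Phi> x z) \<and> \<Phi> 0 z = mat 1)"

definition monodromy :: "(real \<Rightarrow> complex \<Rightarrow> complex^2^2) \<Rightarrow> real \<Rightarrow> complex \<Rightarrow> complex^2^2" where
  "monodromy \<Phi> a z = \<Phi> a z"

definition discriminant :: "(real \<Rightarrow> complex \<Rightarrow> complex^2^2) \<Rightarrow> real \<Rightarrow> complex \<Rightarrow> complex" where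
  "discriminant \<Phi> a z = trace (monodromy \<Phi> a z)"

definition quasimomentum ::
    "(real \<Rightarrow> complex \<Rightarrow> complex^2^2) \<Rightarrow> real \<Rightarrow> (complex \<Rightarrow> complex) \<Rightarrow> bool" where
  "quasimomentum \<Phi> a k \<longleftrightarrow>
     continuous_on {z. 0 \<le> Im z} k \<and>
     (\<forall>z. 0 \<le> Im z \<longrightarrow>
        discriminant \<Phi> a z = 2 * cos (k z * complex_of_real a) \<and> 0 \<le> Im (k z))"

definition eigenvector_for :: "complex^2^2 \<Rightarrow> complex \<Rightarrow> complex^2 \<Rightarrow> bool" where
  "eigenvector_for A z w \<longleftrightarrow> w \<noteq> 0 \<and> A *v w = z *s w"

text \<open>
  \<open>v\<^sub>p\<close> belongs to the eigenvalue outside the unit circle, \<open>v\<^sub>m\<close> to the one inside.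
\<close>
definition monodromy_eigenvectors ::
    "(real \<Rightarrow> complex \<Rightarrow> complex^2^2) \<Rightarrow> real \<Rightarrow> (complex \<Rightarrow> complex) \<Rightarrow>
     (complex \<Rightarrow> complex^2) \<Rightarrow> (complex \<Rightarrow> complex^2) \<Rightarrow> bool" where
  "monodromy_eigenvectors \<Phi> a k v\<^sub>p v\<^sub>m \<longleftrightarrow>
     (\<forall>z. 0 \<le> Im z \<and> discriminant \<Phi> a z \<notin> complex_of_real ` {-2..2} \<longrightarrow>
        eigenvector_for (monodromy \<Phi> a z) (exp (-\<i> * k z * complex_of_real a)) (v\<^sub>p z) \<and>
        eigenvector_for (monodromy \<Phi> a z) (exp (\<i> * k z * complex_of_real a)) (v\<^sub>m z))"

text \<open>
  Only meaningful for \<open>A\<close> with two distinct eigenvalues; the value then does not depend on the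
  choice of eigenvectors or on their order.  The norm on \<^typ>\<open>complex^2\<close> is the Euclidean one.
\<close>
definition eigenvector_angle :: "complex^2^2 \<Rightarrow> real" where
  "eigenvector_angle A =
     (THE r. \<exists>z\<^sub>p z\<^sub>m w\<^sub>p w\<^sub>m. z\<^sub>p \<noteq> z\<^sub>m \<and> eigenvector_for A z\<^sub>p w\<^sub>p \<and> eigenvector_for A z\<^sub>m w\<^sub>m \<and>
        r = norm (det (transpose (vector [w\<^sub>p, w\<^sub>m]))) / (norm w\<^sub>p * norm w\<^sub>m))"

end

(*
In the combinations p = u1 + i u2 and r = u1 - i u2 of the two components the Dirac equation
reads p' = -i (z - q) p + i m r, r' = i (z - q) r - i m p. With the phase T(x) = z x - Q(x), the
functions P = exp (i T) p and R = exp (-i T) r satisfy P' = i m exp (2 i T) R and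
R' = -i m exp (-2 i T) P, where |exp (2 i T(x))| = exp (-2 x Im z). Integrating both equations and
comparing with the maximum of |P| on [0, a] shows that P changes by O(1 / Im z) only and that
exp (2 i T) R = O(1 / Im z), uniformly in Re z. Hence N = exp (i T(a)) M(z) differs from
(I - sigma_2) / 2, which has the eigenvalues 1 and 0, by O(1 / Im z). The remaining assertions are
perturbation theory of N: an eigenvector for the eigenvalue c of N is (1, (c - N11) / N12), and the
angle is controlled by Lagrange's identity. As the solutions are only Caratheodory solutions,
integrating the equations needs the fundamental theorem of calculus for absolutely continuous
functions, for which one takes Henstock-Kurzweil gauges: the intervals tagged in the exceptional null
set lie in an open set of small measure.
*)
theory Submission
  imports Defs
begin

subsection \<open>Absolutely continuous functions\<close>

text \<open>Uniformity in Re z is what the quasimomentum needs. A logarithm determines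
  \<open>k\<close> only modulo 2 pi / a, and a single integer has to serve all \<mu>; the bounds
  therefore hold on a whole half-plane, which is connected, so that a continuous function with
  discrete values is constant on it. Scaling by exp (i T(a)) instead of exp (-\<alpha> a) makes the
  limit matrix independent of \<mu>; the two factors differ by a number of modulus 1. The
  multipliers exp (i k a) and exp (-i k a) come from the trace alone: their scaled sum is 1 + O(1 /
  Im z), and the first has modulus at most 1 as Im k \<ge> 0, hence is negligible after scaling. The
  angle, in contrast, is defined without \<open>k\<close>, so for it the eigenvalues of N are
  constructed by the quadratic formula. As it is a definite description, independence of the choice
  and order of the eigenvectors is part of the proof.\<close>

definition abs_cont_on :: "(real \<Rightarrow> 'a::real_normed_vector) \<Rightarrow> real \<Rightarrow> real \<Rightarrow> bool" where
  "abs_cont_on f s t \<longleftrightarrow>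
     (\<forall>\<epsilon>>0. \<exists>\<delta>>0. \<forall>d. d division_of \<Union>d \<longrightarrow> \<Union>d \<subseteq> {s..t} \<longrightarrow>
        (\<Sum>K\<in>d. Sup K - Inf K) < \<delta> \<longrightarrow> (\<Sum>K\<in>d. norm (f (Sup K) - f (Inf K))) < \<epsilon>)"

lemma locally_absolutely_continuous_iff:
  "locally_absolutely_continuous f \<longleftrightarrow> (\<forall>s t. abs_cont_on f s t)"
  by (simp add: locally_absolutely_continuous_def abs_cont_on_def)

lemma abs_cont_onE:
  assumes "abs_cont_on f s t" "\<epsilon> > 0"
  obtains \<delta> where "\<delta> > 0" "\<And>d. \<lbrakk>d division_of \<Union>d; \<Union>d \<subseteq> {s..t}; (\<Sum>K\<in>d. Sup K - Inf K) < \<delta>\<rbrakk>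
      \<Longrightarrow> (\<Sum>K\<in>d. norm (f (Sup K) - f (Inf K))) < \<epsilon>"
proof -
  from assms obtain \<delta> where "\<delta> > 0" "\<forall>d. d division_of \<Union>d \<longrightarrow> \<Union>d \<subseteq> {s..t} \<longrightarrow>
        (\<Sum>K\<in>d. Sup K - Inf K) < \<delta> \<longrightarrow> (\<Sum>K\<in>d. norm (f (Sup K) - f (Inf K))) < \<epsilon>"
    unfolding abs_cont_on_def by (elim allE[of _ \<epsilon>]) auto
  then show thesis by (intro that[of \<delta>]) simp_all
qed

lemma division_of_real_member:
  fixes d :: "real set set"
  assumes "d division_of \<Union>d" "K \<in> d"
  shows "K = {Inf K..Sup K}" "Inf K \<le> Sup K" "Inf K \<in> \<Union>d" "Sup K \<in> \<Union>d"
    "measure lborel K = Sup K - Inf K"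
proof -
  obtain u v where K: "K = {u..v}" "u \<le> v"
    using division_ofD(3,4)[OF assms] by (metis atLeastatMost_empty_iff2 box_real(2))
  then show "K = {Inf K..Sup K}" "Inf K \<le> Sup K" "measure lborel K = Sup K - Inf K" by auto
  then show "Inf K \<in> \<Union>d" "Sup K \<in> \<Union>d"
    using assms(2) K by (metis UnionI atLeastAtMost_iff order_refl)+
qed

text \<open>The common source of the closure properties: sums, products, exponentials and components
  only need an estimate of increments by increments of functions already known to be absolutely
  continuous.\<close>

lemma abs_cont_on_dominated:
  fixes f :: "real \<Rightarrow> 'a::real_normed_vector" and g :: "real \<Rightarrow> 'b::real_normed_vector"
    and h :: "real \<Rightarrow> 'c::real_normed_vector"
  assumes f: "abs_cont_on f s t" and g: "abs_cont_on g s t"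
    and le: "\<And>x y. \<lbrakk>x \<in> {s..t}; y \<in> {s..t}\<rbrakk> \<Longrightarrow>
               norm (h x - h y) \<le> C * (norm (f x - f y) + norm (g x - g y))"
  shows "abs_cont_on h s t"
  unfolding abs_cont_on_def
proof (intro allI impI)
  fix \<epsilon> :: real assume "\<epsilon> > 0"
  \<comment> \<open>\<open>C\<close> may be zero or negative; \<open>D\<close> dominates it and can
    be divided by.\<close>
  define D where "D = \<bar>C\<bar> + 1"
  have D: "D > 0" "C \<le> D" by (auto simp: D_def)
  have e: "\<epsilon> / (2 * D) > 0" using \<open>\<epsilon> > 0\<close> D by simp
  obtain \<delta>1 where d1: "\<delta>1 > 0" "\<And>d. d division_of \<Union>d \<Longrightarrow> \<Union>d \<subseteq> {s..t} \<Longrightarrow>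
        (\<Sum>K\<in>d. Sup K - Inf K) < \<delta>1 \<Longrightarrow> (\<Sum>K\<in>d. norm (f (Sup K) - f (Inf K))) < \<epsilon> / (2 * D)"
    by (rule abs_cont_onE[OF f e]) simp
  obtain \<delta>2 where d2: "\<delta>2 > 0" "\<And>d. d division_of \<Union>d \<Longrightarrow> \<Union>d \<subseteq> {s..t} \<Longrightarrow>
        (\<Sum>K\<in>d. Sup K - Inf K) < \<delta>2 \<Longrightarrow> (\<Sum>K\<in>d. norm (g (Sup K) - g (Inf K))) < \<epsilon> / (2 * D)"
    by (rule abs_cont_onE[OF g e]) simp
  show "\<exists>\<delta>>0. \<forall>d. d division_of \<Union>d \<longrightarrow> \<Union>d \<subseteq> {s..t} \<longrightarrow>
        (\<Sum>K\<in>d. Sup K - Inf K) < \<delta> \<longrightarrow> (\<Sum>K\<in>d. norm (h (Sup K) - h (Inf K))) < \<epsilon>"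
  proof (intro exI[of _ "min \<delta>1 \<delta>2"] conjI allI impI)
    fix d :: "real set set"
    assume d: "d division_of \<Union>d" "\<Union>d \<subseteq> {s..t}" "(\<Sum>K\<in>d. Sup K - Inf K) < min \<delta>1 \<delta>2"
    have "(\<Sum>K\<in>d. norm (h (Sup K) - h (Inf K)))
        \<le> (\<Sum>K\<in>d. D * (norm (f (Sup K) - f (Inf K)) + norm (g (Sup K) - g (Inf K))))"
    proof (rule sum_mono)
      fix K assume "K \<in> d"
      then have "Inf K \<in> {s..t}" "Sup K \<in> {s..t}"
        using division_of_real_member(3,4)[OF d(1)] d(2) by blast+
      then show "norm (h (Sup K) - h (Inf K))
          \<le> D * (norm (f (Sup K) - f (Inf K)) + norm (g (Sup K) - g (Inf K)))"
        using order_trans[OF le mult_right_mono[OF D(2)]] by simp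
    qed
    also have "\<dots> = D * ((\<Sum>K\<in>d. norm (f (Sup K) - f (Inf K))) + (\<Sum>K\<in>d. norm (g (Sup K) - g (Inf K))))"
      by (simp add: sum.distrib flip: sum_distrib_left)
    also have "\<dots> < D * (\<epsilon> / (2 * D) + \<epsilon> / (2 * D))"
      using d1(2)[of d] d2(2)[of d] d D by (intro mult_strict_left_mono add_strict_mono) auto
    also have "\<dots> = \<epsilon>" using D by (simp add: field_simps)
    finally show "(\<Sum>K\<in>d. norm (h (Sup K) - h (Inf K))) < \<epsilon>" .
  qed (use d1 d2 in auto)
qed

lemma abs_cont_on_lipschitz:
  fixes f :: "real \<Rightarrow> 'a::real_normed_vector"
  assumes "\<And>x y. norm (f x - f y) \<le> C * \<bar>x - y\<bar>"
  shows "abs_cont_on f s t"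
proof -
  have "abs_cont_on (\<lambda>x::real. x) s t"
    unfolding abs_cont_on_def
  proof (intro allI impI)
    fix \<epsilon> :: real assume "\<epsilon> > 0"
    have "(\<Sum>K\<in>d. norm (Sup K - Inf K)) = (\<Sum>K\<in>d. Sup K - Inf K)"
      if "d division_of \<Union>d" for d :: "real set set"
      using division_of_real_member(2)[OF that] by (intro sum.cong) auto
    with \<open>\<epsilon> > 0\<close> show "\<exists>\<delta>>0. \<forall>d. d division_of \<Union>d \<longrightarrow> \<Union>d \<subseteq> {s..t} \<longrightarrow>
        (\<Sum>K\<in>d. Sup K - Inf K) < \<delta> \<longrightarrow> (\<Sum>K\<in>d. norm (Sup K - Inf K)) < \<epsilon>"
      by (intro exI[of _ \<epsilon>]) simp
  qed
  \<comment> \<open>The identity serves as both dominating functions, hence half of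
    \<open>C\<close>.\<close>
  from abs_cont_on_dominated[OF this this, of f "C / 2"] assms show ?thesis
    by (simp add: real_norm_def)
qed

lemma abs_cont_on_imp_continuous_on:
  fixes f :: "real \<Rightarrow> 'a::real_normed_vector"
  assumes f: "abs_cont_on f s t"
  shows "continuous_on {s..t} f"
  unfolding continuous_on_iff
proof (intro ballI allI impI)
  fix x e :: real assume x: "x \<in> {s..t}" and "e > 0"
  then obtain \<delta> where d: "\<delta> > 0" "\<And>d. d division_of \<Union>d \<Longrightarrow> \<Union>d \<subseteq> {s..t} \<Longrightarrow>
        (\<Sum>K\<in>d. Sup K - Inf K) < \<delta> \<Longrightarrow> (\<Sum>K\<in>d. norm (f (Sup K) - f (Inf K))) < e"
    using abs_cont_onE[OF f \<open>e > 0\<close>] by blast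
  have *: "dist (f v) (f u) < e" if "u \<in> {s..t}" "v \<in> {s..t}" "u \<le> v" "v - u < \<delta>" for u v
  proof -
    \<comment> \<open>Continuity is absolute continuity tested on a division with one
      member.\<close>
    have "{{u..v}} division_of {u..v}"
      using division_of_self[of u v] that by simp
    with d(2)[of "{{u..v}}"] that show ?thesis by (simp add: dist_norm)
  qed
  have "dist (f y) (f x) < e" if "y \<in> {s..t}" "dist y x < \<delta>" for y
    using *[of x y] *[of y x] that x by (cases "x \<le> y") (auto simp: dist_real_def dist_commute)
  then show "\<exists>d>0. \<forall>x'\<in>{s..t}. dist x' x < d \<longrightarrow> dist (f x') (f x) < e"
    using d(1) by blast
qed

lemma abs_cont_on_mult:
  fixes f g :: "real \<Rightarrow> 'a::real_normed_algebra"
  assumes f: "abs_cont_on f s t" and g: "abs_cont_on g s t"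
  shows "abs_cont_on (\<lambda>x. f x * g x) s t"
proof -
  have "bounded (f ` {s..t})" "bounded (g ` {s..t})"
    using assms by (simp_all add: abs_cont_on_imp_continuous_on compact_continuous_image compact_imp_bounded)
  then obtain B C where B: "\<And>x. x \<in> {s..t} \<Longrightarrow> norm (f x) \<le> B" and C: "\<And>x. x \<in> {s..t} \<Longrightarrow> norm (g x) \<le> C"
    unfolding bounded_iff by (metis imageI)
  show ?thesis
  proof (rule abs_cont_on_dominated[OF f g])
    fix x y assume xy: "x \<in> {s..t}" "y \<in> {s..t}"
    have "f x * g x - f y * g y = (f x - f y) * g x + f y * (g x - g y)" by (simp add: algebra_simps)
    also have "norm \<dots> \<le> norm (f x - f y) * norm (g x) + norm (f y) * norm (g x - g y)"
      by (intro norm_triangle_le add_mono norm_mult_ineq)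
    also have "\<dots> \<le> norm (f x - f y) * (B + C) + (B + C) * norm (g x - g y)"
      using B[OF xy(1)] C[OF xy(1)] B[OF xy(2)] order_trans[OF norm_ge_zero B[OF xy(1)]]
        order_trans[OF norm_ge_zero C[OF xy(1)]]
      by (intro add_mono mult_left_mono mult_right_mono) auto
    finally show "norm (f x * g x - f y * g y) \<le> (B + C) * (norm (f x - f y) + norm (g x - g y))"
      by (simp add: algebra_simps)
  qed
qed

text \<open>The range of \<open>f\<close> on the compact interval lies in a ball of radius B, on
  which exp is Lipschitz with constant exp B.\<close>

lemma abs_cont_on_exp:
  fixes f :: "real \<Rightarrow> complex"
  assumes f: "abs_cont_on f s t"
  shows "abs_cont_on (\<lambda>x. exp (f x)) s t"
proof -
  have "bounded (f ` {s..t})"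
    using assms by (simp add: abs_cont_on_imp_continuous_on compact_continuous_image compact_imp_bounded)
  then obtain B where B: "\<And>x. x \<in> {s..t} \<Longrightarrow> norm (f x) \<le> B"
    unfolding bounded_iff by (metis imageI)
  show ?thesis
  proof (rule abs_cont_on_dominated[OF f f])
    fix x y assume xy: "x \<in> {s..t}" "y \<in> {s..t}"
    have "norm (exp (f x) - exp (f y)) \<le> exp B * norm (f x - f y)"
    proof (rule field_differentiable_bound[of "cball 0 B" exp exp])
      show "norm (exp z) \<le> exp B" if "z \<in> cball 0 B" for z :: complex
        using that complex_Re_le_cmod[of z] by simp
    qed (use B xy in \<open>auto intro: DERIV_exp has_field_derivative_at_within\<close>)
    then show "norm (exp (f x) - exp (f y)) \<le> exp B / 2 * (norm (f x - f y) + norm (f x - f y))"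
      by simp
  qed
qed

text \<open>A Riemann sum is compared with the telescoping sum of the increments of \<open>f\<close>
  over the same intervals. Tags outside \<open>N\<close> cost at most \<eta> times the length, by
  differentiability; at tags in \<open>N\<close> the integrand is set to 0, so that only the
  increments remain, which absolute continuity makes small. Integrability of \<open>f'\<close> is
  part of the conclusion.\<close>

lemma abs_cont_on_has_integral:
  fixes f :: "real \<Rightarrow> 'a::euclidean_space"
  assumes f: "abs_cont_on f s t" and st: "s \<le> t" and N: "negligible N"
    and der: "\<And>x. x \<in> {s..t} - N \<Longrightarrow> (f has_vector_derivative f' x) (at x)"
  shows "(f' has_integral f t - f s) {s..t}"
proof -
  define g where "g x = (if x \<in> N then 0 else f' x)" for x
  have "(g has_integral f t - f s) {s..t}"
    unfolding has_integral_real
  proof (intro allI impI)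
    fix e :: real assume "e > 0"
    \<comment> \<open>The added 1 keeps the quotient meaningful for s = t; the tags outside
      \<open>N\<close> then cost at most e / 2 in total.\<close>
    define \<eta> where "\<eta> = e / (2 * (t - s + 1))"
    have \<eta>: "\<eta> > 0" using \<open>e > 0\<close> st by (simp add: \<eta>_def)
    obtain \<delta> where d: "\<delta> > 0" "\<And>d. d division_of \<Union>d \<Longrightarrow> \<Union>d \<subseteq> {s..t} \<Longrightarrow>
        (\<Sum>K\<in>d. Sup K - Inf K) < \<delta> \<Longrightarrow> (\<Sum>K\<in>d. norm (f (Sup K) - f (Inf K))) < e / 2"
      using abs_cont_onE[OF f half_gt_zero[OF \<open>e > 0\<close>]] by blast
    have Nn: "N \<in> null_sets lebesgue" using N by (simp add: negligible_iff_null_sets)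
    then obtain U where U: "open U" "N \<subseteq> U" "U - N \<in> lmeasurable" "emeasure lebesgue (U - N) < ennreal \<delta>"
      using sets_lebesgue_outer_open[of N \<delta>] d(1) by auto
    have Um: "U \<in> lmeasurable"
      using U(3) N by (metis Diff_partition U(2) fmeasurable.Un negligible_imp_measurable sup_commute)
    have Ud: "measure lebesgue U < \<delta>"
    proof -
      have "emeasure lebesgue U = emeasure lebesgue (U - N)"
        using emeasure_Diff_null_set[OF Nn, of U] Um by (simp add: fmeasurableD)
      then show ?thesis using U(4) d(1) Um
        by (metis emeasure_eq_measure2 ennreal_less_iff measure_nonneg)
    qed
    have "\<exists>r>0. x \<in> {s..t} - N \<longrightarrow> (\<forall>y. dist x y < r \<longrightarrow> norm (f y - f x - (y - x) *\<^sub>R f' x) \<le> \<eta> * \<bar>y - x\<bar>)" for x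
    proof (cases "x \<in> {s..t} - N")
      case True
      from der[OF this] have "(f has_derivative (\<lambda>h. h *\<^sub>R f' x)) (at x within UNIV)"
        by (simp add: has_vector_derivative_def)
      from this[unfolded has_derivative_within_alt] \<eta> show ?thesis
        by (simp add: dist_norm abs_minus_commute) blast
    qed (auto intro: exI[of _ 1])
    then obtain r where r: "\<And>x. r x > 0"
      "\<And>x y. \<lbrakk>x \<in> {s..t} - N; dist x y < r x\<rbrakk> \<Longrightarrow> norm (f y - f x - (y - x) *\<^sub>R f' x) \<le> \<eta> * \<bar>y - x\<bar>"
      by metis
    define \<gamma> where "\<gamma> x = (if x \<in> N then U else ball x (r x))" for x
    have "gauge \<gamma>" using U r by (auto simp: gauge_def \<gamma>_def)
    moreover have "norm ((\<Sum>(x,k)\<in>\<D>. measure lborel k *\<^sub>R g x) - (f t - f s)) < e"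
      if D: "\<D> tagged_division_of {s..t}" and fine: "\<gamma> fine \<D>" for \<D>
    proof -
      have fin: "finite \<D>" using D by auto
      define \<D>N where "\<D>N = {(x,k). (x,k) \<in> \<D> \<and> x \<in> N}"
      have sub: "\<D>N \<subseteq> \<D>" by (auto simp: \<D>N_def)
      have part: "\<D>N tagged_partial_division_of {s..t}"
        using D sub by (meson tagged_division_of_def tagged_partial_division_subset)
      let ?d = "snd ` \<D>N"
      have div: "?d division_of \<Union>?d" by (rule partial_division_of_tagged_division[OF part])
      have Kprop: "\<exists>u v. k = {u..v} \<and> u \<le> v \<and> x \<in> {u..v} \<and> {u..v} \<subseteq> {s..t}" if "(x,k) \<in> \<D>" for x k
        using tagged_division_ofD(2-4)[OF D that] by (metis atLeastatMost_empty_iff2 box_real(2) empty_iff)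
      have "(\<Sum>K\<in>?d. Sup K - Inf K) = (\<Sum>K\<in>?d. measure lebesgue K)"
      proof (rule sum.cong)
        fix K assume "K \<in> ?d"
        from division_of_real_member(5)[OF div this] division_ofD(4)[OF div this]
        show "Sup K - Inf K = measure lebesgue K" by auto
      qed simp
      also have "\<dots> = measure lebesgue (\<Union>?d)"
        by (rule content_division[OF div])
      also have "\<dots> \<le> measure lebesgue U"
      proof (rule measure_mono_fmeasurable[OF _ _ Um])
        show "\<Union>?d \<subseteq> U" using fine sub by (force simp: fine_def \<D>N_def \<gamma>_def)
        show "\<Union>?d \<in> sets lebesgue" using lmeasurable_division[OF div] by (simp add: fmeasurableD)
      qed
      also note Ud
      finally have small: "(\<Sum>K\<in>?d. norm (f (Sup K) - f (Inf K))) < e / 2"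
        using tagged_partial_division_ofD(3)[OF part] by (intro d(2)[OF div]) force+
      have N_sum: "(\<Sum>(x,k)\<in>\<D>N. norm (f (Sup k) - f (Inf k))) < e / 2"
      proof -
        have "(\<Sum>K\<in>?d. norm (f (Sup K) - f (Inf K))) = (\<Sum>p\<in>\<D>N. norm (f (Sup (snd p)) - f (Inf (snd p))))"
        proof (subst sum.reindex_nontrivial)
          show "finite \<D>N" using fin sub finite_subset by blast
          fix p p' assume p: "p \<in> \<D>N" "p' \<in> \<D>N" "p \<noteq> p'" "snd p = snd p'"
          then have "interior (snd p) \<inter> interior (snd p') = {}"
            using tagged_partial_division_ofD(5)[OF part] by (metis prod.collapse)
          with p have "interior (snd p) = {}" by simp
          moreover obtain u v where "snd p = {u..v}" "u \<le> v"
            using Kprop p sub by (metis prod.collapse subsetD)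
          ultimately show "norm (f (Sup (snd p)) - f (Inf (snd p))) = 0"
            by (simp add: interior_atLeastAtMost_real)
        qed (simp add: o_def)
        with small show ?thesis by (simp add: case_prod_unfold)
      qed
      have "(\<Sum>(x,k)\<in>\<D>. measure lborel k *\<^sub>R g x) - (f t - f s)
          = (\<Sum>(x,k)\<in>\<D>. measure lborel k *\<^sub>R g x - (f (Sup k) - f (Inf k)))"
        using additive_tagged_division_1[OF st D, of f] by (simp add: case_prod_unfold sum_subtractf)
      also have "norm \<dots> \<le> (\<Sum>(x,k)\<in>\<D>. \<eta> * measure lborel k + (if x \<in> N then norm (f (Sup k) - f (Inf k)) else 0))"
      proof (rule sum_norm_le, clarify)
        fix x k assume xk: "(x,k) \<in> \<D>"
        then obtain u v where k: "k = {u..v}" "u \<le> v" "x \<in> {u..v}" "{u..v} \<subseteq> {s..t}" using Kprop by blast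
        show "norm (measure lborel k *\<^sub>R g x - (f (Sup k) - f (Inf k)))
            \<le> \<eta> * measure lborel k + (if x \<in> N then norm (f (Sup k) - f (Inf k)) else 0)"
        proof (cases "x \<in> N")
          case True
          then show ?thesis using \<eta> k by (simp add: g_def norm_minus_commute)
        next
          case False
          have "{u..v} \<subseteq> ball x (r x)" using fineD[OF fine xk] False k by (simp add: \<gamma>_def)
          then have uv: "dist x u < r x" "dist x v < r x" using k by (auto simp: subset_iff)
          have x: "x \<in> {s..t} - N" using k False by auto
          \<comment> \<open>The tag lies between u and v, so the distances from it to both ends add
            up to the length of the interval.\<close>
          have "measure lborel k *\<^sub>R g x - (f v - f u)
              = (f u - f x - (u - x) *\<^sub>R f' x) - (f v - f x - (v - x) *\<^sub>R f' x)"
            using k False by (simp add: g_def algebra_simps)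
          also have "norm \<dots> \<le> \<eta> * \<bar>u - x\<bar> + \<eta> * \<bar>v - x\<bar>"
            by (rule order_trans[OF norm_triangle_ineq4]) (intro add_mono r uv x)
          also have "\<dots> = \<eta> * measure lborel k" using k by (simp add: algebra_simps)
          finally show ?thesis using False k by simp
        qed
      qed
      also have "\<dots> = \<eta> * (t - s) + (\<Sum>(x,k)\<in>\<D>N. norm (f (Sup k) - f (Inf k)))"
      proof -
        have "(\<Sum>(x,k)\<in>\<D>. measure lborel k) = t - s"
          using additive_content_tagged_division[of \<D> s t] D st by simp
        moreover have "(\<Sum>(x,k)\<in>\<D>. if x \<in> N then norm (f (Sup k) - f (Inf k)) else 0)
            = (\<Sum>(x,k)\<in>\<D>N. norm (f (Sup k) - f (Inf k)))"
          by (rule sum.mono_neutral_cong_right[OF fin sub]) (auto simp: \<D>N_def split: if_splits)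
        ultimately show ?thesis
          by (simp add: case_prod_unfold sum.distrib flip: sum_distrib_left)
      qed
      also have "\<dots> < e / 2 + e / 2"
      proof (rule add_le_less_mono[OF _ N_sum])
        show "\<eta> * (t - s) \<le> e / 2"
          using \<open>e > 0\<close> st by (simp add: \<eta>_def field_simps)
      qed
      finally show ?thesis by simp
    qed
    ultimately show "\<exists>\<gamma>. gauge \<gamma> \<and> (\<forall>\<D>. \<D> tagged_division_of {s..t} \<and> \<gamma> fine \<D> \<longrightarrow>
        norm ((\<Sum>(x,k)\<in>\<D>. measure lborel k *\<^sub>R g x) - (f t - f s)) < e)"
      by (intro exI[of _ \<gamma>] conjI allI impI) (assumption, elim conjE)
  qed
  then show ?thesis
    by (rule has_integral_spike[OF N, rotated]) (simp add: g_def)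
qed

subsection \<open>Indefinite integrals\<close>

text \<open>Truncation: |q| is min |q| n plus a remainder \<open>h\<close>, whose integral over the
  whole interval is below \<epsilon> / 2 for suitable n by dominated convergence. On any division
  the bounded part contributes at most n times the total length.\<close>

lemma abs_cont_on_indefinite_integral:
  fixes q :: "real \<Rightarrow> real"
  assumes q: "q absolutely_integrable_on {s..t}"
  shows "abs_cont_on (\<lambda>x. integral {s..x} q) s t"
  unfolding abs_cont_on_def
proof (intro allI impI)
  fix \<epsilon> :: real assume "\<epsilon> > 0"
  define g where "g n x = min \<bar>q x\<bar> (real n)" for n x
  have qi: "q integrable_on {s..t}" and aq: "(\<lambda>x. \<bar>q x\<bar>) absolutely_integrable_on {s..t}"
    using q absolutely_integrable_abs by (auto simp: absolutely_integrable_on_def)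
  have ga: "g n absolutely_integrable_on {s..t}" for n
    unfolding g_def by (intro absolutely_integrable_min_1 aq) (simp add: absolutely_integrable_on_const)
  have gi: "g n integrable_on {s..t}" and aqi: "(\<lambda>x. \<bar>q x\<bar>) integrable_on {s..t}" for n
    using ga aq by (auto simp: absolutely_integrable_on_def)
  have "(\<lambda>n. integral {s..t} (g n)) \<longlonglongrightarrow> integral {s..t} (\<lambda>x. \<bar>q x\<bar>)"
  proof (rule dominated_convergence(2)[OF gi aqi])
    show "(\<lambda>n. g n x) \<longlonglongrightarrow> \<bar>q x\<bar>" for x
    proof (rule tendsto_eventually)
      obtain N where "\<bar>q x\<bar> \<le> real N" using real_arch_simple by blast
      then show "\<forall>\<^sub>F n in sequentially. g n x = \<bar>q x\<bar>"
        by (auto simp: g_def eventually_sequentially intro!: exI[of _ N])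
    qed
  qed (auto simp: g_def)
  from LIMSEQ_D[OF this half_gt_zero[OF \<open>\<epsilon> > 0\<close>]] obtain n
    where n: "norm (integral {s..t} (g n) - integral {s..t} (\<lambda>x. \<bar>q x\<bar>)) < \<epsilon> / 2" by blast
  define h where "h x = \<bar>q x\<bar> - g n x" for x
  have hi: "h integrable_on {s..t}" unfolding h_def by (intro integrable_diff aqi gi)
  have h0: "h x \<ge> 0" for x by (simp add: h_def g_def)
  have hs: "integral {s..t} h < \<epsilon> / 2"
    using n integral_diff[OF aqi gi, of n] unfolding h_def real_norm_def by linarith
  show "\<exists>\<delta>>0. \<forall>d. d division_of \<Union>d \<longrightarrow> \<Union>d \<subseteq> {s..t} \<longrightarrow> (\<Sum>K\<in>d. Sup K - Inf K) < \<delta> \<longrightarrow>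
      (\<Sum>K\<in>d. norm (integral {s..Sup K} q - integral {s..Inf K} q)) < \<epsilon>"
  \<comment> \<open>n may be 0, hence the added 1; the bounded part then stays within \<epsilon> /
    2.\<close>
  proof (intro exI[of _ "\<epsilon> / (2 * (real n + 1))"] conjI allI impI)
    fix d :: "real set set"
    assume d: "d division_of \<Union>d" "\<Union>d \<subseteq> {s..t}" "(\<Sum>K\<in>d. Sup K - Inf K) < \<epsilon> / (2 * (real n + 1))"
    have "(\<Sum>K\<in>d. norm (integral {s..Sup K} q - integral {s..Inf K} q))
        \<le> (\<Sum>K\<in>d. integral K h + real n * (Sup K - Inf K))"
    proof (rule sum_mono)
      fix K assume "K \<in> d"
      then obtain u v where K: "K = {u..v}" "u \<le> v"
        using division_ofD(3,4)[OF d(1)] by (metis atLeastatMost_empty_iff2 box_real(2))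
      have sub: "{u..v} \<subseteq> {s..t}" using d(2) \<open>K \<in> d\<close> K by blast
      then have uv: "s \<le> u" "v \<le> t" using K by auto
      have int: "f integrable_on {u..v}" if "f integrable_on {s..t}" for f :: "real \<Rightarrow> real"
        using that sub by (rule integrable_on_subinterval)
      have "q integrable_on {s..v}" using qi uv by (auto intro: integrable_on_subinterval)
      from Henstock_Kurzweil_Integration.integral_combine[OF uv(1) K(2) this]
      have "norm (integral {s..v} q - integral {s..u} q) = norm (integral {u..v} q)"
        by (simp add: algebra_simps)
      also have "\<dots> \<le> integral {u..v} (\<lambda>x. h x + real n)"
        by (intro integral_norm_bound_integral integrable_add int qi hi)
           (auto simp: h_def g_def intro: integrable_const_ivl)
      also have "\<dots> = integral {u..v} h + real n * (v - u)"
        using K by (subst integral_add) (auto intro: int hi)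
      finally show "norm (integral {s..Sup K} q - integral {s..Inf K} q)
          \<le> integral K h + real n * (Sup K - Inf K)"
        using K by simp
    qed
    also have "\<dots> = integral (\<Union>d) h + real n * (\<Sum>K\<in>d. Sup K - Inf K)"
    proof -
      have "h integrable_on \<Union>d"
        by (meson d(1,2) hi integrable_on_subdivision)
      then show ?thesis
        using integral_combine_division_topdown[OF _ d(1), of h]
        by (simp add: sum.distrib flip: sum_distrib_left)
    qed
    also have "\<dots> < \<epsilon> / 2 + \<epsilon> / 2"
    proof (rule add_less_le_mono)
      have "integral (\<Union>d) h \<le> integral {s..t} h"
        by (rule integral_subset_le[OF d(2)]) (use hi h0 d integrable_on_subdivision in blast)+
      then show "integral (\<Union>d) h < \<epsilon> / 2" using hs by simp
      have "real n * (\<Sum>K\<in>d. Sup K - Inf K) \<le> real n * (\<epsilon> / (2 * (real n + 1)))"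
        using d(3) by (intro mult_left_mono) auto
      also have "\<dots> \<le> \<epsilon> / 2" using \<open>\<epsilon> > 0\<close> by (simp add: field_simps)
      finally show "real n * (\<Sum>K\<in>d. Sup K - Inf K) \<le> \<epsilon> / 2" .
    qed
    finally show "(\<Sum>K\<in>d. norm (integral {s..Sup K} q - integral {s..Inf K} q)) < \<epsilon>" by simp
  qed (use \<open>\<epsilon> > 0\<close> in auto)
qed

text \<open>The left-hand difference quotients are the right-hand ones of the reflected function.\<close>
lemma indefinite_integral_has_derivative_ae:
  fixes q :: "real \<Rightarrow> real"
  assumes q: "\<And>u v. q integrable_on {u..v}"
  obtains N where "negligible N"
    "\<And>x t. \<lbrakk>x \<notin> N; s < x; x < t\<rbrakk> \<Longrightarrow> ((\<lambda>y. integral {s..y} q) has_real_derivative q x) (at x)"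
proof -
  define q' where "q' x = q (- x)" for x
  have q': "q' integrable_on {u..v}" for u v
    using q[of "- v" "- u"] Henstock_Kurzweil_Integration.integrable_reflect_real[where f = q and a = "- v" and b = "- u"]
    by (simp add: q'_def [abs_def])
  obtain N1 where N1: "negligible N1" "\<And>x e. \<lbrakk>x \<notin> N1; 0 < e\<rbrakk> \<Longrightarrow>
      \<exists>d>0. \<forall>h. 0 < h \<and> h < d \<longrightarrow> norm (integral {x..x + h} q /\<^sub>R h - q x) < e"
    by (rule integrable_ccontinuous_explicit[of q]) (use q in \<open>auto simp: cbox_interval\<close>)
  obtain N2 where N2: "negligible N2" "\<And>x e. \<lbrakk>x \<notin> N2; 0 < e\<rbrakk> \<Longrightarrow>
      \<exists>d>0. \<forall>h. 0 < h \<and> h < d \<longrightarrow> norm (integral {x..x + h} q' /\<^sub>R h - q' x) < e"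
    by (rule integrable_ccontinuous_explicit[of q']) (use q' in \<open>auto simp: cbox_interval\<close>)
  have "negligible (uminus ` N2)"
    by (rule negligible_differentiable_image_negligible[OF _ N2(1)])
       (auto simp: differentiable_on_def)
  show thesis
  proof
    show "negligible (N1 \<union> uminus ` N2)" using N1 \<open>negligible (uminus ` N2)\<close> by simp
    fix x t assume x: "x \<notin> N1 \<union> uminus ` N2" "s < x" "x < t"
    show "((\<lambda>y. integral {s..y} q) has_real_derivative q x) (at x)"
      unfolding has_field_derivative_def has_derivative_at_alt
    proof (intro conjI allI impI)
      show "bounded_linear ((*) (q x))" by (rule bounded_linear_mult_right)
      fix e :: real assume "e > 0"
      obtain d1 where d1: "d1 > 0" "\<And>h. \<lbrakk>0 < h; h < d1\<rbrakk> \<Longrightarrow> norm (integral {x..x + h} q /\<^sub>R h - q x) < e"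
        using N1(2)[of x e] x \<open>e > 0\<close> by auto
      have "- x \<notin> N2" using x by force
      then obtain d2 where d2: "d2 > 0" "\<And>h. \<lbrakk>0 < h; h < d2\<rbrakk> \<Longrightarrow> norm (integral {- x..- x + h} q' /\<^sub>R h - q' (- x)) < e"
        using N2(2)[of "- x" e] \<open>e > 0\<close> by auto
      show "\<exists>d>0. \<forall>y. norm (y - x) < d \<longrightarrow>
          norm (integral {s..y} q - integral {s..x} q - q x * (y - x)) \<le> e * norm (y - x)"
      \<comment> \<open>The bound x - s keeps y to the right of the base point s, so that the
        integrals can be combined.\<close>
      proof (intro exI[of _ "min (min d1 d2) (x - s)"] conjI allI impI)
        fix y assume y: "norm (y - x) < min (min d1 d2) (x - s)"
        consider "y = x" | "y > x" | "y < x" by linarith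
        then show "norm (integral {s..y} q - integral {s..x} q - q x * (y - x)) \<le> e * norm (y - x)"
        proof cases
          case 2
          define h where "h = y - x"
          have h: "0 < h" "h < d1" "y = x + h" using 2 y by (auto simp: h_def)
          have "integral {s..y} q - integral {s..x} q = integral {x..x + h} q"
            using Henstock_Kurzweil_Integration.integral_combine[of s x y q] q x h by simp
          moreover have "\<bar>integral {x..x + h} q - q x * h\<bar> = \<bar>integral {x..x + h} q /\<^sub>R h - q x\<bar> * \<bar>h\<bar>"
            using h by (simp add: abs_mult[symmetric] field_simps)
          ultimately show ?thesis
            using d1(2)[OF h(1,2)] h by (simp add: mult_right_mono)
        next
          case 3
          define h where "h = x - y"
          have h: "0 < h" "h < d2" "y = x - h" "s < y" using 3 y by (auto simp: h_def)
          have "integral {y..x} q = integral {- x..- x + h} q'"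
            using Henstock_Kurzweil_Integration.integral_reflect_real[where f = q and a = y and b = x] h by (simp add: q'_def [abs_def] add.commute)
          then have "integral {s..y} q - integral {s..x} q = - integral {- x..- x + h} q'"
            using Henstock_Kurzweil_Integration.integral_combine[of s y x q] q x h by simp
          moreover have "\<bar>- integral {- x..- x + h} q' + q x * h\<bar>
              = \<bar>integral {- x..- x + h} q' /\<^sub>R h - q x\<bar> * \<bar>h\<bar>"
            using h by (simp add: abs_mult[symmetric] field_simps abs_minus_commute)
          ultimately show ?thesis
            using d2(2)[OF h(1,2)] h by (simp add: mult_right_mono q'_def)
        qed simp
      qed (use d1 d2 x in auto)
    qed
  qed
qed

subsection \<open>The diagonalised Dirac system\<close>

lemma abs_cont_on_subset:
  assumes "abs_cont_on f s t" "{u..v} \<subseteq> {s..t}"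
  shows "abs_cont_on f u v"
  unfolding abs_cont_on_def
proof (intro allI impI)
  fix \<epsilon> :: real assume "\<epsilon> > 0"
  obtain \<delta> where "\<delta> > 0"
    "\<And>d. \<lbrakk>d division_of \<Union>d; \<Union>d \<subseteq> {s..t}; (\<Sum>K\<in>d. Sup K - Inf K) < \<delta>\<rbrakk>
      \<Longrightarrow> (\<Sum>K\<in>d. norm (f (Sup K) - f (Inf K))) < \<epsilon>"
    by (rule abs_cont_onE[OF assms(1) \<open>\<epsilon> > 0\<close>]) simp
  then show "\<exists>\<delta>>0. \<forall>d. d division_of \<Union>d \<longrightarrow> \<Union>d \<subseteq> {u..v} \<longrightarrow>
        (\<Sum>K\<in>d. Sup K - Inf K) < \<delta> \<longrightarrow> (\<Sum>K\<in>d. norm (f (Sup K) - f (Inf K))) < \<epsilon>"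
    using assms(2) by (intro exI[of _ \<delta>] conjI allI impI) (simp_all add: order_trans)
qed

section \<open>A priori bounds for the coupled integral equations\<close>

lemma has_integral_norm_le:
  fixes f :: "'n::euclidean_space \<Rightarrow> 'a::banach"
  assumes "(f has_integral i) S" "(g has_integral j) S" "\<And>x. x \<in> S \<Longrightarrow> norm (f x) \<le> g x"
  shows "norm i \<le> j"
  using integral_norm_bound_integral[of f S g] assms by (metis has_integral_iff)

text \<open>With \<open>B\<close> the maximum of |P|, the second equation bounds R up to the growth
  exp (2 \<alpha> x) of 1 / E, which multiplication by E removes. Inserted into the first equation
  this estimates P, and hence \<open>B\<close>, by \<open>B\<close> itself with a small coefficient;
  it follows that B \<le> 3, which is the 3 in both bounds.\<close>

lemma coupled_integral_bound:
  fixes P R E :: "real \<Rightarrow> complex" and m a \<alpha> :: real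
  assumes "m \<ge> 0" "a > 0" "\<alpha> > 0" and \<alpha>: "m \<le> \<alpha>" "m\<^sup>2 * a \<le> \<alpha>"
    and contP: "continuous_on {0..a} P"
    and E: "\<And>x. norm (E x) = exp (- (2 * \<alpha> * x))"
    and P: "\<And>x. x \<in> {0..a} \<Longrightarrow> ((\<lambda>t. \<i> * m * (E t * R t)) has_integral P x - P 0) {0..x}"
    and R: "\<And>x. x \<in> {0..a} \<Longrightarrow> ((\<lambda>t. - (\<i> * m) * (P t / E t)) has_integral R x - R 0) {0..x}"
    and init: "norm (P 0) \<le> 1" "norm (R 0) \<le> 1"
  shows "norm (P a - P 0) \<le> (m + 3 * m\<^sup>2 * a) / (2 * \<alpha>)"
    and "norm (E a * R a) \<le> (1 / a + 3 * m) / (2 * \<alpha>)"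
proof -
  have "compact ((\<lambda>x. norm (P x)) ` {0..a})" "(\<lambda>x. norm (P x)) ` {0..a} \<noteq> {}"
    using contP \<open>a > 0\<close> by (auto intro!: compact_continuous_image continuous_intros)
  from compact_attains_sup[OF this] obtain x0
    where x0: "x0 \<in> {0..a}" and sup: "\<And>x. x \<in> {0..a} \<Longrightarrow> norm (P x) \<le> norm (P x0)" by auto
  define B where "B = norm (P x0)"
  have B: "B \<ge> 0" by (simp add: B_def)
  have ER: "norm (E x * R x) \<le> exp (- (2 * \<alpha> * x)) + m * B / (2 * \<alpha>)" if x: "x \<in> {0..a}" for x
  proof -
    have I: "((\<lambda>t. m * B * exp (2 * \<alpha> * t)) has_integral
        m * B * exp (2 * \<alpha> * x) / (2 * \<alpha>) - m * B * exp (2 * \<alpha> * 0) / (2 * \<alpha>)) {0..x}"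
      by (rule fundamental_theorem_of_calculus)
         (use x \<open>\<alpha> > 0\<close> in \<open>auto intro!: derivative_eq_intros simp flip: has_real_derivative_iff_has_vector_derivative\<close>)
    have "norm (R x - R 0) \<le> m * B * exp (2 * \<alpha> * x) / (2 * \<alpha>) - m * B * exp (2 * \<alpha> * 0) / (2 * \<alpha>)"
    proof (rule has_integral_norm_le[OF R[OF x] I])
      fix t assume "t \<in> {0..x}"
      then have "t \<in> {0..a}" using x by auto
      then show "norm (- (\<i> * m) * (P t / E t)) \<le> m * B * exp (2 * \<alpha> * t)"
        using sup[of t] \<open>m \<ge> 0\<close> by (simp add: norm_mult norm_divide E exp_minus B_def field_simps mult_left_mono)
    qed
    also have "\<dots> \<le> m * B / (2 * \<alpha>) * exp (2 * \<alpha> * x)"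
      using \<open>m \<ge> 0\<close> B \<open>\<alpha> > 0\<close> by simp
    finally have "norm (R x) \<le> 1 + m * B / (2 * \<alpha>) * exp (2 * \<alpha> * x)"
      using init(2) norm_triangle_sub[of "R x" "R 0"] by linarith
    then have "norm (E x) * norm (R x) \<le> norm (E x) * (1 + m * B / (2 * \<alpha>) * exp (2 * \<alpha> * x))"
      by (rule mult_left_mono) simp
    also have "\<dots> = exp (- (2 * \<alpha> * x)) + m * B / (2 * \<alpha>) * (exp (- (2 * \<alpha> * x)) * exp (2 * \<alpha> * x))"
      by (simp add: E algebra_simps)
    finally show ?thesis by (simp add: norm_mult flip: exp_add)
  qed
  have P_diff: "norm (P x - P 0) \<le> (m + m\<^sup>2 * a * B) / (2 * \<alpha>)" if x: "x \<in> {0..a}" for x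
  proof -
    have I: "((\<lambda>t. m * (exp (- (2 * \<alpha> * t)) + m * B / (2 * \<alpha>))) has_integral
        (m * (- exp (- (2 * \<alpha> * x)) / (2 * \<alpha>) + m * B / (2 * \<alpha>) * x))
        - (m * (- exp (- (2 * \<alpha> * 0)) / (2 * \<alpha>) + m * B / (2 * \<alpha>) * 0))) {0..x}"
      by (rule fundamental_theorem_of_calculus)
         (use x \<open>\<alpha> > 0\<close> in \<open>auto intro!: derivative_eq_intros simp flip: has_real_derivative_iff_has_vector_derivative\<close>)
    have "norm (P x - P 0) \<le> (m * (- exp (- (2 * \<alpha> * x)) / (2 * \<alpha>) + m * B / (2 * \<alpha>) * x))
        - (m * (- exp (- (2 * \<alpha> * 0)) / (2 * \<alpha>) + m * B / (2 * \<alpha>) * 0))"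
    proof (rule has_integral_norm_le[OF P[OF x] I])
      fix t assume "t \<in> {0..x}"
      then have "t \<in> {0..a}" using x by auto
      from mult_left_mono[OF ER[OF this] \<open>m \<ge> 0\<close>]
      show "norm (\<i> * m * (E t * R t)) \<le> m * (exp (- (2 * \<alpha> * t)) + m * B / (2 * \<alpha>))"
        using \<open>m \<ge> 0\<close> by (simp add: norm_mult)
    qed
    also have "\<dots> \<le> (m + m\<^sup>2 * B * x) / (2 * \<alpha>)"
      using \<open>\<alpha> > 0\<close> \<open>m \<ge> 0\<close> by (simp add: field_simps power2_eq_square)
    also have "\<dots> \<le> (m + m\<^sup>2 * B * a) / (2 * \<alpha>)"
      using x B \<open>\<alpha> > 0\<close> by (intro divide_right_mono add_left_mono mult_left_mono) auto
    finally show ?thesis by (simp add: mult_ac)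
  qed
  have "B \<le> 1 + (m + m\<^sup>2 * a * B) / (2 * \<alpha>)"
    using P_diff[OF x0] norm_triangle_sub[of "P x0" "P 0"] init(1) by (simp add: B_def)
  \<comment> \<open>The two thresholds for \<alpha> serve to make the coefficient of
    \<open>B\<close> at most 1/2, so that \<open>B\<close> can be absorbed on the left.\<close>
  also have "\<dots> \<le> 1 + (\<alpha> + \<alpha> * B) / (2 * \<alpha>)"
    using \<alpha> B \<open>\<alpha> > 0\<close> by (intro add_left_mono divide_right_mono add_mono mult_right_mono) auto
  also have "\<dots> = 3 / 2 + B / 2" using \<open>\<alpha> > 0\<close> by (simp add: field_simps)
  finally have B3: "B \<le> 3" by simp
  have "norm (P a - P 0) \<le> (m + m\<^sup>2 * a * B) / (2 * \<alpha>)" using P_diff[of a] \<open>a > 0\<close> by simp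
  also have "\<dots> \<le> (m + m\<^sup>2 * a * 3) / (2 * \<alpha>)"
    using B3 \<open>a > 0\<close> \<open>\<alpha> > 0\<close> by (intro divide_right_mono add_left_mono mult_left_mono) auto
  finally show "norm (P a - P 0) \<le> (m + 3 * m\<^sup>2 * a) / (2 * \<alpha>)" by (simp add: mult_ac)
  \<comment> \<open>The initial value of R survives with the weight exp (-2 \<alpha> a); this crude
    bound of the weight is the origin of 1 / a.\<close>
  have "2 * \<alpha> * a \<le> exp (2 * \<alpha> * a)" using exp_ge_add_one_self[of "2 * \<alpha> * a"] by linarith
  then have "exp (- (2 * \<alpha> * a)) \<le> 1 / (2 * \<alpha> * a)"
    using \<open>a > 0\<close> \<open>\<alpha> > 0\<close> by (simp add: exp_minus field_simps)
  moreover have "m * B / (2 * \<alpha>) \<le> m * 3 / (2 * \<alpha>)"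
    using B3 \<open>m \<ge> 0\<close> \<open>\<alpha> > 0\<close> by (intro divide_right_mono mult_left_mono) auto
  ultimately have "norm (E a * R a) \<le> 1 / (2 * \<alpha> * a) + m * 3 / (2 * \<alpha>)"
    using ER[of a] \<open>a > 0\<close> by simp
  also have "\<dots> = (1 / a + 3 * m) / (2 * \<alpha>)" using \<open>a > 0\<close> \<open>\<alpha> > 0\<close> by (simp add: field_simps)
  finally show "norm (E a * R a) \<le> (1 / a + 3 * m) / (2 * \<alpha>)" .
qed

text \<open>The function T with a plain integral instead of \<open>potential_integral\<close>: the
  two agree for x \<ge> 0, and the argument stays on [0, a].\<close>

definition phase :: "(real \<Rightarrow> real) \<Rightarrow> complex \<Rightarrow> real \<Rightarrow> complex" where
  "phase q z x = z * complex_of_real x - complex_of_real (integral {0..x} q)"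

text \<open>The system couples only the two entries of a column, so each column is treated by
  itself. The first bound compares P(a) with P(0); the quantity in the second is exp (2 i T(a))
  R(a).\<close>

lemma dirac_column_bound:
  fixes m a :: real and \<Psi> :: "real \<Rightarrow> complex^2^2" and z :: complex and j :: 2
  assumes "m \<ge> 0" "a > 0" and q: "locally_integrable q"
    and sol: "dirac_solution m q z \<Psi>" and z: "0 < Im z" "m \<le> Im z" "m\<^sup>2 * a \<le> Im z"
    and init: "\<Psi> 0 = mat 1"
  shows "norm (exp (\<i> * phase q z a) * (\<Psi> a $ 1 $ j + \<i> * \<Psi> a $ 2 $ j) - (mat 1 $ 1 $ j + \<i> * mat 1 $ 2 $ j))
           \<le> (m + 3 * m\<^sup>2 * a) / (2 * Im z)"
    and "norm (exp (\<i> * phase q z a) * (\<Psi> a $ 1 $ j - \<i> * \<Psi> a $ 2 $ j)) \<le> (1 / a + 3 * m) / (2 * Im z)"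
proof -
  let ?T = "phase q z"
  define p where "p x = \<Psi> x $ 1 $ j + \<i> * \<Psi> x $ 2 $ j" for x
  define r where "r x = \<Psi> x $ 1 $ j - \<i> * \<Psi> x $ 2 $ j" for x
  define P where "P x = exp (\<i> * ?T x) * p x" for x
  define R where "R x = exp (- (\<i> * ?T x)) * r x" for x
  define E where "E x = exp (2 * \<i> * ?T x)" for x
  have qint: "q absolutely_integrable_on {u..v}" "q integrable_on {u..v}" for u v
    using q by (auto simp: locally_integrable_def absolutely_integrable_on_def)
  have ac\<Psi>: "abs_cont_on \<Psi> 0 a"
    using sol by (simp add: dirac_solution_def locally_absolutely_continuous_iff)
  have ac_entry: "abs_cont_on (\<lambda>x. \<Psi> x $ i $ j) 0 a" for i
  proof (rule abs_cont_on_dominated[OF ac\<Psi> ac\<Psi>, where C = "1 / 2"])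
    fix x y
    have "norm (\<Psi> x $ i $ j - \<Psi> y $ i $ j) = norm ((\<Psi> x - \<Psi> y) $ i $ j)" by simp
    also have "\<dots> \<le> norm (\<Psi> x - \<Psi> y)"
      by (rule order_trans[OF Finite_Cartesian_Product.norm_nth_le Finite_Cartesian_Product.norm_nth_le])
    finally show "norm (\<Psi> x $ i $ j - \<Psi> y $ i $ j) \<le> 1 / 2 * (norm (\<Psi> x - \<Psi> y) + norm (\<Psi> x - \<Psi> y))"
      by simp
  qed
  have ac_p: "abs_cont_on p 0 a" and ac_r: "abs_cont_on r 0 a"
  proof -
    have *: "norm (u - v) \<le> 1 * (norm u + norm v)" "norm (u + v) \<le> 1 * (norm u + norm v)" for u v :: complex
      by (simp_all add: norm_triangle_ineq norm_triangle_ineq4)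
    have "p x - p y = (\<Psi> x $ 1 $ j - \<Psi> y $ 1 $ j) + \<i> * (\<Psi> x $ 2 $ j - \<Psi> y $ 2 $ j)"
      "r x - r y = (\<Psi> x $ 1 $ j - \<Psi> y $ 1 $ j) - \<i> * (\<Psi> x $ 2 $ j - \<Psi> y $ 2 $ j)" for x y
      by (simp_all add: p_def r_def algebra_simps)
    then have "norm (p x - p y) \<le> 1 * (norm (\<Psi> x $ 1 $ j - \<Psi> y $ 1 $ j) + norm (\<Psi> x $ 2 $ j - \<Psi> y $ 2 $ j))"
      "norm (r x - r y) \<le> 1 * (norm (\<Psi> x $ 1 $ j - \<Psi> y $ 1 $ j) + norm (\<Psi> x $ 2 $ j - \<Psi> y $ 2 $ j))" for x y
      using *[of "\<Psi> x $ 1 $ j - \<Psi> y $ 1 $ j" "\<i> * (\<Psi> x $ 2 $ j - \<Psi> y $ 2 $ j)"]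
      by (simp_all add: norm_mult)
    then show "abs_cont_on p 0 a" "abs_cont_on r 0 a"
      by (auto intro!: abs_cont_on_dominated[OF ac_entry[of 1] ac_entry[of 2], where C = 1])
  qed
  have ac_T: "abs_cont_on ?T 0 a"
  proof (rule abs_cont_on_dominated[OF abs_cont_on_lipschitz[of "\<lambda>x. z * complex_of_real x" "norm z"]
        abs_cont_on_indefinite_integral[OF qint(1)], where C = 1])
    fix x y
    show "norm (z * complex_of_real x - z * complex_of_real y) \<le> norm z * \<bar>x - y\<bar>"
      by (simp add: norm_mult flip: right_diff_distrib of_real_diff)
    have "?T x - ?T y = (z * complex_of_real x - z * complex_of_real y)
        - complex_of_real (integral {0..x} q - integral {0..y} q)"
      by (simp add: phase_def)
    then show "norm (?T x - ?T y) \<le> 1 * (norm (z * complex_of_real x - z * complex_of_real y)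
        + norm (integral {0..x} q - integral {0..y} q))"
      using norm_triangle_ineq4 by (metis mult_1 norm_of_real real_norm_def)
  qed
  have ac_exp: "abs_cont_on (\<lambda>x. exp (c * ?T x)) 0 a" for c
    by (intro abs_cont_on_exp abs_cont_on_mult ac_T abs_cont_on_lipschitz[where C = 0]) simp
  have ac_P: "abs_cont_on P 0 a" and ac_R: "abs_cont_on R 0 a"
    using abs_cont_on_mult[OF ac_exp[of \<i>] ac_p] abs_cont_on_mult[OF ac_exp[of "- \<i>"] ac_r]
    by (simp_all add: P_def[abs_def] R_def[abs_def])
  obtain N1 where N1: "negligible N1"
    "\<And>x t. \<lbrakk>x \<notin> N1; 0 < x; x < t\<rbrakk> \<Longrightarrow> ((\<lambda>y. integral {0..y} q) has_real_derivative q x) (at x)"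
    using indefinite_integral_has_derivative_ae[OF qint(2)] by blast
  obtain N2 where N2: "negligible N2"
    "\<And>x. x \<notin> N2 \<Longrightarrow> \<exists>\<Psi>'. (\<Psi> has_vector_derivative \<Psi>') (at x) \<and>
        (-\<i>) *\<^sub>M (\<sigma>2 ** \<Psi>') + (complex_of_real m *\<^sub>M \<sigma>3 + complex_of_real (q x) *\<^sub>M mat 1) ** \<Psi> x
          = z *\<^sub>M \<Psi> x"
  proof -
    from sol have "AE x in lebesgue. \<exists>\<Psi>'. (\<Psi> has_vector_derivative \<Psi>') (at x) \<and>
        (-\<i>) *\<^sub>M (\<sigma>2 ** \<Psi>') + (complex_of_real m *\<^sub>M \<sigma>3 + complex_of_real (q x) *\<^sub>M mat 1) ** \<Psi> x
          = z *\<^sub>M \<Psi> x" by (simp add: dirac_solution_def)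
    from AE_E3[OF this] show thesis
      using that by (auto simp: negligible_iff_null_sets)
  qed
  define N where "N = N1 \<union> N2 \<union> {0, a}"
  have N: "negligible N" using N1 N2 by (simp add: N_def)
  have der: "(P has_vector_derivative \<i> * m * (E x * R x)) (at x)"
    "(R has_vector_derivative - (\<i> * m) * (P x / E x)) (at x)" if x: "x \<in> {0..a} - N" for x
  proof -
    have "x \<notin> N1" "x \<notin> N2" "0 < x" "x < a" using x by (auto simp: N_def)
    obtain \<Psi>' where \<Psi>': "(\<Psi> has_vector_derivative \<Psi>') (at x)"
      "(-\<i>) *\<^sub>M (\<sigma>2 ** \<Psi>') + (complex_of_real m *\<^sub>M \<sigma>3 + complex_of_real (q x) *\<^sub>M mat 1) ** \<Psi> x
          = z *\<^sub>M \<Psi> x" using N2(2)[OF \<open>x \<notin> N2\<close>] by blast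
    have entry: "((\<lambda>y. \<Psi> y $ i $ j) has_vector_derivative \<Psi>' $ i $ j) (at x)" for i
      by (intro bounded_linear.has_vector_derivative[OF bounded_linear_vec_nth] \<Psi>'(1))
    have ode1: "\<Psi>' $ 1 $ j = (z - q x + m) * \<Psi> x $ 2 $ j"
      and ode2: "\<Psi>' $ 2 $ j = - (z - q x - m) * \<Psi> x $ 1 $ j"
    proof -
      have "((-\<i>) *\<^sub>M (\<sigma>2 ** \<Psi>') + (complex_of_real m *\<^sub>M \<sigma>3 + complex_of_real (q x) *\<^sub>M mat 1) ** \<Psi> x) $ i $ j
          = (z *\<^sub>M \<Psi> x) $ i $ j" for i using \<Psi>'(2) by simp
      from this[of 1] this[of 2]
      have e1: "- \<Psi>' $ 2 $ j + (m + q x) * \<Psi> x $ 1 $ j = z * \<Psi> x $ 1 $ j"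
        and e2: "\<Psi>' $ 1 $ j + (q x - m) * \<Psi> x $ 2 $ j = z * \<Psi> x $ 2 $ j"
        by (simp_all add: cscale_def matrix_matrix_mult_def sum_2 \<sigma>2_def \<sigma>3_def mat_def)
      show "\<Psi>' $ 1 $ j = (z - q x + m) * \<Psi> x $ 2 $ j" using e2 by (simp add: algebra_simps)
      show "\<Psi>' $ 2 $ j = - (z - q x - m) * \<Psi> x $ 1 $ j" using e1 by (simp add: algebra_simps)
    qed
    \<comment> \<open>The rows (1, i) and (1, -i) diagonalise the system up to the coupling by m.
      The remaining diagonal coefficients are what the derivatives of the exponentials in P and R
      cancel.\<close>
    have p': "(p has_vector_derivative - \<i> * (z - q x) * p x + \<i> * m * r x) (at x)"
      unfolding p_def[abs_def] r_def
      by (rule has_vector_derivative_eq_rhs[OF has_vector_derivative_add[OF entry[of 1]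
            has_vector_derivative_mult_right[OF entry[of 2], of \<i>]]])
         (simp add: ode1 ode2 algebra_simps)
    have r': "(r has_vector_derivative \<i> * (z - q x) * r x - \<i> * m * p x) (at x)"
      unfolding r_def[abs_def] p_def
      by (rule has_vector_derivative_eq_rhs[OF has_vector_derivative_diff[OF entry[of 1]
            has_vector_derivative_mult_right[OF entry[of 2], of \<i>]]])
         (simp add: ode1 ode2 algebra_simps)
    have T': "(?T has_vector_derivative z - q x) (at x)"
      unfolding phase_def[abs_def]
      by (rule has_vector_derivative_eq_rhs[OF has_vector_derivative_diff[OF
            has_vector_derivative_mult_right[OF has_vector_derivative_of_real[OF DERIV_ident]]
            has_vector_derivative_of_real[OF N1(2)[OF \<open>x \<notin> N1\<close> \<open>0 < x\<close> \<open>x < a\<close>]]]]) simp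
    have exp': "((\<lambda>y. exp (c * ?T y)) has_vector_derivative c * (z - q x) * exp (c * ?T x)) (at x)" for c
      using field_vector_diff_chain_at[OF has_vector_derivative_mult_right[OF T', of c] DERIV_exp]
      by (simp add: o_def)
    have E_split: "E x = exp (\<i> * ?T x) * exp (\<i> * ?T x)" by (simp add: E_def mult.assoc flip: exp_add)
    have cancel: "exp (\<i> * ?T x) * exp (- (\<i> * ?T x)) = 1" by (simp flip: exp_add)
    have "(P has_vector_derivative exp (\<i> * ?T x) * (- \<i> * (z - q x) * p x + \<i> * m * r x)
        + \<i> * (z - q x) * exp (\<i> * ?T x) * p x) (at x)"
      unfolding P_def[abs_def] by (rule has_vector_derivative_mult[OF exp' p'])
    moreover have "exp (\<i> * ?T x) * (- \<i> * (z - q x) * p x + \<i> * m * r x)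
        + \<i> * (z - q x) * exp (\<i> * ?T x) * p x = \<i> * m * (E x * R x)"
    proof -
      have "E x * R x = exp (\<i> * ?T x) * r x"
        unfolding E_split R_def using cancel by (metis mult.assoc mult_1)
      then show ?thesis by (simp add: algebra_simps)
    qed
    ultimately show "(P has_vector_derivative \<i> * m * (E x * R x)) (at x)" by simp
    have "(R has_vector_derivative exp (- (\<i> * ?T x)) * (\<i> * (z - q x) * r x - \<i> * m * p x)
        + - \<i> * (z - q x) * exp (- (\<i> * ?T x)) * r x) (at x)"
      unfolding R_def[abs_def] using has_vector_derivative_mult[OF exp'[of "- \<i>"] r'] by simp
    moreover have "exp (- (\<i> * ?T x)) * (\<i> * (z - q x) * r x - \<i> * m * p x)
        + - \<i> * (z - q x) * exp (- (\<i> * ?T x)) * r x = - (\<i> * m) * (P x / E x)"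
    proof -
      have "P x / E x = exp (- (\<i> * ?T x)) * p x"
        unfolding E_split P_def by (simp add: exp_minus field_simps)
      then show ?thesis by (simp add: algebra_simps)
    qed
    ultimately show "(R has_vector_derivative - (\<i> * m) * (P x / E x)) (at x)" by simp
  qed
  have sub: "abs_cont_on f 0 x" if "abs_cont_on f 0 a" "x \<in> {0..a}" for f :: "real \<Rightarrow> complex" and x
    by (rule abs_cont_on_subset[OF that(1)]) (use that(2) in auto)
  have T0: "?T 0 = 0" by (simp add: phase_def)
  have j: "j = 1 \<or> j = 2" using exhaust_2 by auto
  have init': "P 0 = mat 1 $ 1 $ j + \<i> * mat 1 $ 2 $ j" "R 0 = mat 1 $ 1 $ j - \<i> * mat 1 $ 2 $ j"
    by (simp_all add: P_def R_def p_def r_def T0 init)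
  have norm_E: "norm (E x) = exp (- (2 * Im z * x))" for x
    by (simp add: E_def phase_def)
  note bound = coupled_integral_bound[of m a "Im z" P E R, OF \<open>m \<ge> 0\<close> \<open>a > 0\<close> z
      abs_cont_on_imp_continuous_on[OF ac_P] norm_E]
  have P_int: "((\<lambda>t. \<i> * m * (E t * R t)) has_integral P x - P 0) {0..x}" if "x \<in> {0..a}" for x
    by (rule abs_cont_on_has_integral[OF sub[OF ac_P that] _ N]) (use that der in auto)
  have R_int: "((\<lambda>t. - (\<i> * m) * (P t / E t)) has_integral R x - R 0) {0..x}" if "x \<in> {0..a}" for x
    by (rule abs_cont_on_has_integral[OF sub[OF ac_R that] _ N]) (use that der in auto)
  \<comment> \<open>The initial values are entries of the rows (1, i) and (1, -i), hence of modulus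
    1.\<close>
  have n: "norm (P 0) \<le> 1" "norm (R 0) \<le> 1"
    using j by (auto simp: init' mat_def)
  have "E a * R a = exp (\<i> * ?T a) * r a"
    by (simp add: E_def R_def mult.assoc [symmetric] flip: exp_add)
  with bound[OF P_int R_int n]
  show "norm (exp (\<i> * phase q z a) * (\<Psi> a $ 1 $ j + \<i> * \<Psi> a $ 2 $ j) - (mat 1 $ 1 $ j + \<i> * mat 1 $ 2 $ j))
           \<le> (m + 3 * m\<^sup>2 * a) / (2 * Im z)"
    and "norm (exp (\<i> * phase q z a) * (\<Psi> a $ 1 $ j - \<i> * \<Psi> a $ 2 $ j)) \<le> (1 / a + 3 * m) / (2 * Im z)"
    by (simp_all add: init'(1)) (simp_all add: P_def p_def r_def)
qed

subsection \<open>Two-by-two matrices near the limit\<close>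

abbreviation limit_matrix :: "complex^2^2" where
  "limit_matrix \<equiv> (1/2) *\<^sub>M (mat 1 - \<sigma>2)"

lemma cscale_nth [simp]: "(c *\<^sub>M A) $ i $ j = c * A $ i $ j"
  by (simp add: cscale_def)

lemma limit_matrix_nth [simp]:
  "limit_matrix $ 1 $ 1 = 1 / 2" "limit_matrix $ 1 $ 2 = \<i> / 2"
  "limit_matrix $ 2 $ 1 = - \<i> / 2" "limit_matrix $ 2 $ 2 = 1 / 2"
  by (simp_all add: mat_def \<sigma>2_def)

lemma norm_vec2_le:
  fixes v :: "'a::real_normed_vector ^ 2"
  shows "norm v \<le> norm (v $ 1) + norm (v $ 2)"
  using L2_set_le_sum[of UNIV "\<lambda>i. norm (v $ i)"] by (simp add: norm_vec_def sum_2)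

lemma norm_vec2:
  fixes v :: "complex ^ 2"
  shows "norm v = sqrt ((norm (v $ 1))\<^sup>2 + (norm (v $ 2))\<^sup>2)"
  by (simp add: norm_vec_def L2_set_def sum_2)

lemma eigenvector_for_rows:
  "eigenvector_for A z w \<longleftrightarrow> w \<noteq> 0 \<and>
     A $ 1 $ 1 * w $ 1 + A $ 1 $ 2 * w $ 2 = z * w $ 1 \<and> A $ 2 $ 1 * w $ 1 + A $ 2 $ 2 * w $ 2 = z * w $ 2"
  by (auto simp: eigenvector_for_def vec_eq_iff forall_2 matrix_vector_mult_def sum_2)

lemma eigenvector_for_cscale:
  assumes "eigenvector_for A z w"
  shows "eigenvector_for (c *\<^sub>M A) (c * z) w"
  using assms by (simp add: eigenvector_for_rows mult.assoc flip: distrib_left)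

section \<open>Eigenvectors of a two-by-two matrix through their slopes\<close>

definition slope :: "complex^2^2 \<Rightarrow> complex \<Rightarrow> complex" where
  "slope A z = (z - A $ 1 $ 1) / A $ 1 $ 2"

text \<open>The first row of the eigenvalue equation yields the slope and excludes a vanishing first
  component; the second row, after inserting the slope, is the characteristic equation.\<close>

lemma eigenvector_slope:
  assumes "A $ 1 $ 2 \<noteq> 0" and w: "eigenvector_for A z w"
  shows "w $ 1 \<noteq> 0" "w $ 2 = slope A z * w $ 1"
    and "z * z - (A $ 1 $ 1 + A $ 2 $ 2) * z + det A = 0"
proof -
  have eqs: "w \<noteq> 0" "A $ 1 $ 1 * w $ 1 + A $ 1 $ 2 * w $ 2 = z * w $ 1"
    "A $ 2 $ 1 * w $ 1 + A $ 2 $ 2 * w $ 2 = z * w $ 2"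
    using w by (auto simp: eigenvector_for_rows)
  show w2: "w $ 2 = slope A z * w $ 1"
    using eqs(2) assms(1) by (simp add: slope_def field_simps)
  show w1: "w $ 1 \<noteq> 0"
  proof
    assume "w $ 1 = 0"
    with w2 have "w = 0" by (simp add: vec_eq_iff forall_2)
    with eqs(1) show False by simp
  qed
  have "(A $ 2 $ 1 + A $ 2 $ 2 * slope A z) * w $ 1 = (z * slope A z) * w $ 1"
    using eqs(3) w2 by (simp add: algebra_simps)
  with w1 have "A $ 2 $ 1 + A $ 2 $ 2 * slope A z = z * slope A z" by simp
  then show "z * z - (A $ 1 $ 1 + A $ 2 $ 2) * z + det A = 0"
    using assms(1) by (simp add: slope_def det_2 field_simps)
qed

lemma eigenvector_exists:
  assumes "A $ 1 $ 2 \<noteq> 0" "z * z - (A $ 1 $ 1 + A $ 2 $ 2) * z + det A = 0"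
  shows "eigenvector_for A z (vector [1, slope A z])"
proof -
  have "vector [1, slope A z] \<noteq> (0 :: complex^2)"
    by (metis vector_2(1) zero_index zero_neq_one)
  then show ?thesis
    using assms by (simp add: eigenvector_for_rows slope_def det_2 field_simps)
qed

text \<open>The quotient defining the angle for the vectors (1, u) and (1, v): the sine of the angle
  between the complex lines they span.\<close>

definition slope_angle :: "complex \<Rightarrow> complex \<Rightarrow> real" where
  "slope_angle u v = norm (u - v) / (sqrt (1 + (norm u)\<^sup>2) * sqrt (1 + (norm v)\<^sup>2))"

lemma slope_angle_commute: "slope_angle u v = slope_angle v u"
  by (simp add: slope_angle_def norm_minus_commute mult.commute)

text \<open>Numerator and denominator scale alike in each vector, so the first components
  cancel.\<close>

lemma norm_det_slopes:
  fixes w\<^sub>p w\<^sub>m :: "complex^2"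
  assumes "w\<^sub>p $ 1 \<noteq> 0" "w\<^sub>m $ 1 \<noteq> 0" "w\<^sub>p $ 2 = u * w\<^sub>p $ 1" "w\<^sub>m $ 2 = v * w\<^sub>m $ 1"
  shows "norm (det (transpose (vector [w\<^sub>p, w\<^sub>m]))) / (norm w\<^sub>p * norm w\<^sub>m) = slope_angle u v"
proof -
  have n: "norm w = norm (w $ 1) * sqrt (1 + (norm t)\<^sup>2)" if "w $ 2 = t * w $ 1" for w :: "complex^2" and t
  proof -
    have "(norm (w $ 1))\<^sup>2 + (norm (w $ 2))\<^sup>2 = (norm (w $ 1))\<^sup>2 * (1 + (norm t)\<^sup>2)"
      by (simp add: that norm_mult power_mult_distrib algebra_simps)
    then show ?thesis by (simp add: norm_vec2 real_sqrt_mult)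
  qed
  have "det (transpose (vector [w\<^sub>p, w\<^sub>m])) = (w\<^sub>p $ 1 * w\<^sub>m $ 1) * (v - u)"
    by (simp add: det_2 Finite_Cartesian_Product.transpose_def assms algebra_simps)
  then have d: "norm (det (transpose (vector [w\<^sub>p, w\<^sub>m]))) = norm (w\<^sub>p $ 1) * norm (w\<^sub>m $ 1) * norm (u - v)"
    by (simp add: norm_mult norm_minus_commute)
  show ?thesis
    unfolding d n[OF assms(3)] n[OF assms(4)] slope_angle_def using assms(1,2) by simp
qed

text \<open>Makes the definite description computable. Any competing pair of eigenvalues is the
  given pair, possibly in the other order, and the value is symmetric in the two slopes.\<close>

lemma eigenvector_angle_eq:
  assumes A: "A $ 1 $ 2 \<noteq> 0" and "z\<^sub>p \<noteq> z\<^sub>m"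
    and "eigenvector_for A z\<^sub>p w\<^sub>p" "eigenvector_for A z\<^sub>m w\<^sub>m"
  shows "eigenvector_angle A = slope_angle (slope A z\<^sub>p) (slope A z\<^sub>m)"
  unfolding eigenvector_angle_def
proof (rule the_equality)
  show "\<exists>z\<^sub>p' z\<^sub>m' w\<^sub>p' w\<^sub>m'. z\<^sub>p' \<noteq> z\<^sub>m' \<and> eigenvector_for A z\<^sub>p' w\<^sub>p' \<and> eigenvector_for A z\<^sub>m' w\<^sub>m' \<and>
      slope_angle (slope A z\<^sub>p) (slope A z\<^sub>m)
        = norm (det (transpose (vector [w\<^sub>p', w\<^sub>m']))) / (norm w\<^sub>p' * norm w\<^sub>m')"
  proof (rule exI[where x = z\<^sub>p], rule exI[where x = z\<^sub>m], rule exI[where x = w\<^sub>p], rule exI[where x = w\<^sub>m],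
      intro conjI)
    show "slope_angle (slope A z\<^sub>p) (slope A z\<^sub>m)
        = norm (det (transpose (vector [w\<^sub>p, w\<^sub>m]))) / (norm w\<^sub>p * norm w\<^sub>m)"
      by (rule norm_det_slopes[symmetric]) (rule eigenvector_slope[OF A], rule assms)+
  qed fact+
next
  fix r
  assume "\<exists>z\<^sub>p' z\<^sub>m' w\<^sub>p' w\<^sub>m'. z\<^sub>p' \<noteq> z\<^sub>m' \<and> eigenvector_for A z\<^sub>p' w\<^sub>p' \<and> eigenvector_for A z\<^sub>m' w\<^sub>m' \<and>
      r = norm (det (transpose (vector [w\<^sub>p', w\<^sub>m']))) / (norm w\<^sub>p' * norm w\<^sub>m')"
  then obtain y\<^sub>p y\<^sub>m u\<^sub>p u\<^sub>m where y: "y\<^sub>p \<noteq> y\<^sub>m" "eigenvector_for A y\<^sub>p u\<^sub>p" "eigenvector_for A y\<^sub>m u\<^sub>m"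
    and r: "r = norm (det (transpose (vector [u\<^sub>p, u\<^sub>m]))) / (norm u\<^sub>p * norm u\<^sub>m)" by blast
  note slope = eigenvector_slope[OF A]
  have r': "r = slope_angle (slope A y\<^sub>p) (slope A y\<^sub>m)"
    unfolding r by (rule norm_det_slopes[OF slope(1)[OF y(2)] slope(1)[OF y(3)] slope(2)[OF y(2)] slope(2)[OF y(3)]])
  let ?T = "A $ 1 $ 1 + A $ 2 $ 2"
  have z: "z\<^sub>p * z\<^sub>p - ?T * z\<^sub>p + det A = 0" "z\<^sub>m * z\<^sub>m - ?T * z\<^sub>m + det A = 0"
    using slope(3) assms by blast+
  have "(z\<^sub>p - z\<^sub>m) * (z\<^sub>p + z\<^sub>m - ?T) = 0" using z by algebra
  with \<open>z\<^sub>p \<noteq> z\<^sub>m\<close> have T: "?T = z\<^sub>p + z\<^sub>m" by simp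
  \<comment> \<open>With the trace equal to the sum of the two eigenvalues, the characteristic
    polynomial splits into the corresponding linear factors, so there is no third
    eigenvalue.\<close>
  have root: "y = z\<^sub>p \<or> y = z\<^sub>m" if "eigenvector_for A y u" for y u
  proof -
    have "y * y - ?T * y + det A = 0" using slope(3) that by blast
    with z T have "(y - z\<^sub>p) * (y - z\<^sub>m) = 0" by algebra
    then show ?thesis by simp
  qed
  from root[OF y(2)] root[OF y(3)] y(1) show "r = slope_angle (slope A z\<^sub>p) (slope A z\<^sub>m)"
    unfolding r' by (auto simp: slope_angle_commute)
qed

text \<open>Scaling changes the eigenvalues but not the eigenvectors. The two described predicates
  are shown to coincide, so the equation holds even where the description is not meaningful.\<close>

lemma eigenvector_angle_cscale:
  assumes "c \<noteq> 0"
  shows "eigenvector_angle (c *\<^sub>M A) = eigenvector_angle A"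
proof -
  let ?S = "\<lambda>A r. \<exists>z\<^sub>p z\<^sub>m w\<^sub>p w\<^sub>m. z\<^sub>p \<noteq> z\<^sub>m \<and> eigenvector_for A z\<^sub>p w\<^sub>p \<and> eigenvector_for A z\<^sub>m w\<^sub>m \<and>
        r = norm (det (transpose (vector [w\<^sub>p, w\<^sub>m]))) / (norm w\<^sub>p * norm w\<^sub>m)"
  have *: "?S (d *\<^sub>M B) r" if S: "?S B r" and d: "d \<noteq> 0" for B r d
  proof -
    obtain z\<^sub>p z\<^sub>m w\<^sub>p w\<^sub>m where "z\<^sub>p \<noteq> z\<^sub>m" "eigenvector_for B z\<^sub>p w\<^sub>p" "eigenvector_for B z\<^sub>m w\<^sub>m"
      "r = norm (det (transpose (vector [w\<^sub>p, w\<^sub>m]))) / (norm w\<^sub>p * norm w\<^sub>m)" using S by blast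
    with d show ?thesis
      by - (rule exI[where x = "d * z\<^sub>p"], rule exI[where x = "d * z\<^sub>m"], rule exI[where x = w\<^sub>p],
        rule exI[where x = w\<^sub>m], intro conjI eigenvector_for_cscale, simp_all)
  qed
  have inv: "(1 / c) *\<^sub>M (c *\<^sub>M A) = A" using assms by (simp add: vec_eq_iff)
  have eq: "?S (c *\<^sub>M A) r \<longleftrightarrow> ?S A r" for r
  proof
    assume "?S (c *\<^sub>M A) r"
    from *[OF this, of "1 / c"] show "?S A r"
      unfolding inv using assms by simp
  next
    assume "?S A r"
    from *[OF this \<open>c \<noteq> 0\<close>] show "?S (c *\<^sub>M A) r" .
  qed
  show ?thesis unfolding eigenvector_angle_def by (simp only: eq)
qed

text \<open>By Lagrange's identity the square of the angle is 1 - G / W, where \<open>G\<close>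
  vanishes at u = -i, v = i and \<open>W\<close> is at least 1.\<close>

lemma slope_angle_near_one:
  assumes u: "norm (u + \<i>) \<le> \<eta>" and v: "norm (v - \<i>) \<le> \<eta>" and "\<eta> \<le> 1"
  shows "\<bar>slope_angle u v - 1\<bar> \<le> 9 * \<eta>"
proof -
  define W where "W = (1 + (norm u)\<^sup>2) * (1 + (norm v)\<^sup>2)"
  define G where "G = (norm (1 + u * cnj v))\<^sup>2"
  have "complex_of_real ((norm (u - v))\<^sup>2 + G) = complex_of_real W"
    unfolding G_def W_def by (simp add: complex_norm_square algebra_simps del: of_real_power)
  then have lagrange: "(norm (u - v))\<^sup>2 + G = W" using of_real_eq_iff by blast
  have W: "W \<ge> 1" by (simp add: W_def algebra_simps add_nonneg_nonneg)
  have sq: "(slope_angle u v)\<^sup>2 = 1 - G / W"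
  proof -
    have "(slope_angle u v)\<^sup>2 = (norm (u - v))\<^sup>2 / W"
      by (simp add: slope_angle_def W_def power_divide power_mult_distrib add_nonneg_nonneg)
    also have "\<dots> = 1 - G / W" using lagrange W by (simp add: field_simps)
    finally show ?thesis .
  qed
  have "\<eta> \<ge> 0" using u norm_ge_zero order_trans by blast
  \<comment> \<open>Expansion about u = -i, v = i; the three terms give 3 \<eta>, whose square is
    the 9 of the claim.\<close>
  have "1 + u * cnj v = (u + \<i>) * cnj (v - \<i>) - \<i> * (u + \<i>) - \<i> * cnj (v - \<i>)"
    by (simp add: algebra_simps)
  also have "norm \<dots> \<le> norm (u + \<i>) * norm (v - \<i>) + norm (u + \<i>) + norm (v - \<i>)"
    by (rule order_trans[OF norm_triangle_ineq4] order_trans[OF add_right_mono[OF norm_triangle_ineq4]])+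
       (simp add: norm_mult del: complex_cnj_diff)
  also have "\<dots> \<le> \<eta> * 1 + \<eta> + \<eta>"
    using u v \<open>\<eta> \<le> 1\<close> \<open>\<eta> \<ge> 0\<close> by (intro add_mono mult_mono) auto
  finally have "G \<le> (3 * \<eta>)\<^sup>2" unfolding G_def by (intro power_mono) auto
  also have "\<dots> \<le> 9 * \<eta>" using \<open>\<eta> \<ge> 0\<close> \<open>\<eta> \<le> 1\<close> by (simp add: power2_eq_square mult_left_le)
  finally have G: "G \<le> 9 * \<eta>" .
  have "G / W \<le> G" "0 \<le> G / W" using W by (auto simp: G_def divide_le_eq mult_left_le mult_le_cancel_left1)
  moreover have s0: "slope_angle u v \<ge> 0" by (simp add: slope_angle_def)
  moreover have s1: "slope_angle u v \<le> 1"
    by (rule power2_le_imp_le) (use sq \<open>0 \<le> G / W\<close> in simp_all)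
  \<comment> \<open>For s in [0, 1] the inequality s^2 \<le> s turns a bound of 1 - s^2 into one of
    1 - s without handling a square root.\<close>
  moreover have "(slope_angle u v)\<^sup>2 \<le> slope_angle u v"
    using s0 s1 by (simp add: power2_eq_square mult_left_le)
  ultimately show ?thesis using sq G by (simp add: abs_le_iff)
qed

text \<open>The threshold 1 / 100 is generous: it keeps the upper right entry away from 0, separates
  the two eigenvalues, and makes the deviation of the slopes, at most 48 \<delta>, smaller than
  1.\<close>

locale near_limit =
  fixes N :: "complex^2^2" and \<delta> :: real
  assumes near: "norm (N $ i $ j - limit_matrix $ i $ j) \<le> \<delta>" and small: "\<delta> \<le> 1 / 100"
begin

lemma entries:
  "norm (N $ 1 $ 1 - 1 / 2) \<le> \<delta>" "norm (N $ 1 $ 2 - \<i> / 2) \<le> \<delta>"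
  "norm (N $ 2 $ 1 + \<i> / 2) \<le> \<delta>" "norm (N $ 2 $ 2 - 1 / 2) \<le> \<delta>"
  using near[of 1 1] near[of 1 2] near[of 2 1] near[of 2 2] by (simp_all add: limit_matrix_nth del: cscale_nth)

lemma delta_nonneg: "\<delta> \<ge> 0"
  using order_trans[OF norm_ge_zero near] .

lemma N12: "norm (N $ 1 $ 2) \<ge> 1 / 4" "N $ 1 $ 2 \<noteq> 0"
proof -
  show "norm (N $ 1 $ 2) \<ge> 1 / 4"
    using entries(2) small norm_triangle_sub[of "\<i> / 2" "N $ 1 $ 2"] by (simp add: norm_minus_commute norm_divide)
  then show "N $ 1 $ 2 \<noteq> 0" by auto
qed

lemma trace_near: "norm (N $ 1 $ 1 + N $ 2 $ 2 - 1) \<le> 2 * \<delta>"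
proof -
  have "N $ 1 $ 1 + N $ 2 $ 2 - 1 = (N $ 1 $ 1 - 1 / 2) + (N $ 2 $ 2 - 1 / 2)" by simp
  also have "norm \<dots> \<le> \<delta> + \<delta>" by (intro norm_triangle_mono entries)
  finally show ?thesis by simp
qed

text \<open>The limit matrix has slope -i at the eigenvalue 1 and i at 0. The difference from these
  values has a numerator linear in the errors, with one \<delta> from each of two entries; the 4
  comes from the lower bound 1 / 4 of the denominator.\<close>

lemma slope_near:
  shows "norm (z - 1) \<le> \<epsilon> \<Longrightarrow> norm (slope N z + \<i>) \<le> 4 * (\<epsilon> + 2 * \<delta>)"
    and "norm z \<le> \<epsilon> \<Longrightarrow> norm (slope N z - \<i>) \<le> 4 * (\<epsilon> + 2 * \<delta>)"
proof -
  have bound: "norm ((x - (N $ 1 $ 1 - 1 / 2) + y * (N $ 1 $ 2 - \<i> / 2)) / N $ 1 $ 2) \<le> 4 * (\<epsilon> + 2 * \<delta>)"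
    if "norm x \<le> \<epsilon>" "norm y = 1" for x y
  proof -
    have "norm (x - (N $ 1 $ 1 - 1 / 2) + y * (N $ 1 $ 2 - \<i> / 2)) \<le> (\<epsilon> + \<delta>) + \<delta>"
      using that entries(1,2) norm_triangle_ineq4[of x "N $ 1 $ 1 - 1 / 2"]
        norm_triangle_ineq[of "x - (N $ 1 $ 1 - 1 / 2)" "y * (N $ 1 $ 2 - \<i> / 2)"]
        norm_mult[of y "N $ 1 $ 2 - \<i> / 2"] by simp
    moreover have "\<epsilon> + 2 * \<delta> \<ge> 0" using that delta_nonneg norm_ge_zero[of x] by linarith
    ultimately have "norm (x - (N $ 1 $ 1 - 1 / 2) + y * (N $ 1 $ 2 - \<i> / 2)) / norm (N $ 1 $ 2) \<le> (\<epsilon> + 2 * \<delta>) / (1 / 4)"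
      using N12 by (intro frac_le) auto
    then show ?thesis by (simp add: norm_divide)
  qed
  have "slope N z + \<i> = (z - 1 - (N $ 1 $ 1 - 1 / 2) + \<i> * (N $ 1 $ 2 - \<i> / 2)) / N $ 1 $ 2"
    using N12(2) by (simp add: slope_def field_simps)
  then show "norm (z - 1) \<le> \<epsilon> \<Longrightarrow> norm (slope N z + \<i>) \<le> 4 * (\<epsilon> + 2 * \<delta>)"
    using bound[of "z - 1" \<i>] by simp
  have "slope N z - \<i> = (z - (N $ 1 $ 1 - 1 / 2) + (- \<i>) * (N $ 1 $ 2 - \<i> / 2)) / N $ 1 $ 2"
    using N12(2) by (simp add: slope_def field_simps)
  then show "norm z \<le> \<epsilon> \<Longrightarrow> norm (slope N z - \<i>) \<le> 4 * (\<epsilon> + 2 * \<delta>)"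
    using bound[of z "- \<i>"] by simp
qed

lemma normalised_eigenvector:
  assumes v: "eigenvector_for N z v"
  shows "v $ 1 \<noteq> 0"
    and "norm (z - 1) \<le> \<epsilon> \<Longrightarrow> norm ((1 / v $ 1) *s v - vector [1, - \<i>]) \<le> 4 * (\<epsilon> + 2 * \<delta>)"
    and "norm z \<le> \<epsilon> \<Longrightarrow> norm ((1 / v $ 1) *s v - vector [1, \<i>]) \<le> 4 * (\<epsilon> + 2 * \<delta>)"
proof -
  note s = eigenvector_slope[OF N12(2) v]
  show "v $ 1 \<noteq> 0" by (rule s(1))
  have "norm ((1 / v $ 1) *s v - vector [1, c]) \<le> norm (slope N z - c)" for c
    using norm_vec2_le[of "(1 / v $ 1) *s v - vector [1, c]"] s(1,2) by simp
  from this[of "- \<i>"] this[of \<i>]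
  show "norm (z - 1) \<le> \<epsilon> \<Longrightarrow> norm ((1 / v $ 1) *s v - vector [1, - \<i>]) \<le> 4 * (\<epsilon> + 2 * \<delta>)"
    and "norm z \<le> \<epsilon> \<Longrightarrow> norm ((1 / v $ 1) *s v - vector [1, \<i>]) \<le> 4 * (\<epsilon> + 2 * \<delta>)"
    using slope_near[of z \<epsilon>] by (auto intro: order_trans)
qed

text \<open>The discriminant of the characteristic polynomial is 1 + O(\<delta>), so the quadratic
  formula puts the eigenvalues within 10 \<delta> of 1 and 0. The slopes are then within 4 (10 + 2)
  \<delta> = 48 \<delta> of -i and i, and 432 is 9 times 48.\<close>

lemma eigenvector_angle_near: "\<bar>eigenvector_angle N - 1\<bar> \<le> 432 * \<delta>"
proof -
  define T where "T = N $ 1 $ 1 + N $ 2 $ 2"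
  define s where "s = csqrt (T\<^sup>2 - 4 * det N)"
  have T: "norm (T - 1) \<le> 2 * \<delta>" using trace_near by (simp add: T_def)
  have dd: "\<delta> * \<delta> \<le> \<delta> / 100" using small delta_nonneg mult_left_mono[of \<delta> "1/100" \<delta>] by simp
  have det: "norm (det N) \<le> 3 * \<delta>"
  proof -
    define x y u v where "x = N $ 1 $ 1 - 1 / 2" and "y = N $ 2 $ 2 - 1 / 2"
      and "u = N $ 1 $ 2 - \<i> / 2" and "v = N $ 2 $ 1 + \<i> / 2"
    \<comment> \<open>The limit matrix is singular, so only terms linear and quadratic in the errors
      are left.\<close>
    have "det N = (x + y) / 2 + (\<i> / 2) * (u - v) + (x * y - u * v)"
      by (simp add: det_2 x_def y_def u_def v_def field_simps)
    also have "norm \<dots> \<le> \<delta> + \<delta> + (\<delta> * \<delta> + \<delta> * \<delta>)"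
    proof (intro norm_triangle_mono)
      have xy: "norm x \<le> \<delta>" "norm y \<le> \<delta>" "norm u \<le> \<delta>" "norm v \<le> \<delta>"
        using entries by (simp_all add: x_def y_def u_def v_def)
      show "norm ((x + y) / 2) \<le> \<delta>" using norm_triangle_mono[OF xy(1,2)] by (simp add: norm_divide)
      show "norm (\<i> / 2 * (u - v)) \<le> \<delta>"
        using norm_triangle_ineq4[of u v] xy by (simp add: norm_mult norm_divide)
      have "norm (x * y) \<le> \<delta> * \<delta>" "norm (u * v) \<le> \<delta> * \<delta>"
        using xy delta_nonneg by (simp_all add: norm_mult mult_mono)
      then show "norm (x * y - u * v) \<le> \<delta> * \<delta> + \<delta> * \<delta>"
        using norm_triangle_ineq4[of "x * y" "u * v"] by linarith
    qed
    finally show ?thesis using dd delta_nonneg by linarith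
  qed
  have ss: "s * s = T\<^sup>2 - 4 * det N" by (simp add: s_def flip: power2_eq_square)
  have "norm (s * s - 1) \<le> 18 * \<delta>"
  proof -
    have "s * s - 1 = (T - 1) * (T - 1) + 2 * (T - 1) - 4 * det N"
      by (simp add: ss power2_eq_square algebra_simps)
    also have "norm \<dots> \<le> norm (T - 1) * norm (T - 1) + 2 * norm (T - 1) + 4 * norm (det N)"
      using norm_triangle_ineq4[of "(T - 1) * (T - 1) + 2 * (T - 1)" "4 * det N"]
        norm_triangle_ineq[of "(T - 1) * (T - 1)" "2 * (T - 1)"]
      unfolding norm_mult norm_numeral by linarith
    also have "\<dots> \<le> (2 * \<delta>) * (2 * \<delta>) + 2 * (2 * \<delta>) + 4 * (3 * \<delta>)"
      using T det delta_nonneg by (intro add_mono mult_mono) auto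
    finally show ?thesis using dd delta_nonneg by simp
  qed
  moreover have "norm (s - 1) \<le> norm (s * s - 1)"
  proof -
    \<comment> \<open>The principal square root lies in the right half-plane, hence has distance at
      least 1 from -1; this singles out the root near 1.\<close>
    have "Re s \<ge> 0" using csqrt_principal[of "T\<^sup>2 - 4 * det N"] unfolding s_def by linarith
    then have "1 \<le> norm (s + 1)" using complex_Re_le_cmod[of "s + 1"] by simp
    then have "norm (s - 1) * 1 \<le> norm (s - 1) * norm (s + 1)" by (intro mult_left_mono) auto
    also have "\<dots> = norm (s * s - 1)" by (simp add: algebra_simps flip: norm_mult)
    finally show ?thesis by simp
  qed
  ultimately have s: "norm (s - 1) \<le> 18 * \<delta>" by linarith
  define y\<^sub>p y\<^sub>m where "y\<^sub>p = (T + s) / 2" and "y\<^sub>m = (T - s) / 2"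
  have "norm (((T - 1) + (s - 1)) / 2) \<le> 10 * \<delta>" "norm (((T - 1) - (s - 1)) / 2) \<le> 10 * \<delta>"
    unfolding norm_divide norm_numeral
    using norm_triangle_ineq[of "T - 1" "s - 1"] norm_triangle_ineq4[of "T - 1" "s - 1"] s T
    by linarith+
  moreover have "((T - 1) + (s - 1)) / 2 = y\<^sub>p - 1" "((T - 1) - (s - 1)) / 2 = y\<^sub>m"
    by (simp_all add: y\<^sub>p_def y\<^sub>m_def field_simps)
  ultimately have yp: "norm (y\<^sub>p - 1) \<le> 10 * \<delta>" and ym: "norm y\<^sub>m \<le> 10 * \<delta>"
    by (simp_all only:)
  have "y\<^sub>p \<noteq> y\<^sub>m"
  proof
    assume "y\<^sub>p = y\<^sub>m"
    then have "norm (1 :: complex) \<le> 20 * \<delta>"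
      using norm_triangle_ineq4[of y\<^sub>m "y\<^sub>p - 1"] yp ym by simp
    then show False using small by simp
  qed
  have char: "y * y - (N $ 1 $ 1 + N $ 2 $ 2) * y + det N = 0" if "y = y\<^sub>p \<or> y = y\<^sub>m" for y
  proof -
    have "(2 * y\<^sub>p - T) * (2 * y\<^sub>p - T) = s * s" "(2 * y\<^sub>m - T) * (2 * y\<^sub>m - T) = s * s"
      by (simp_all add: y\<^sub>p_def y\<^sub>m_def field_simps)
    with that have "(2 * y - T) * (2 * y - T) = s * s" by blast
    then have "4 * (y * y - T * y + det N) = 0"
      unfolding ss by (simp add: power2_eq_square algebra_simps)
    then show ?thesis unfolding T_def mult_eq_0_iff by (metis zero_neq_numeral)
  qed
  have "eigenvector_angle N = slope_angle (slope N y\<^sub>p) (slope N y\<^sub>m)"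
    by (intro eigenvector_angle_eq[OF N12(2) \<open>y\<^sub>p \<noteq> y\<^sub>m\<close> eigenvector_exists[OF N12(2)] eigenvector_exists[OF N12(2)]] char) auto
  moreover have "\<bar>slope_angle (slope N y\<^sub>p) (slope N y\<^sub>m) - 1\<bar> \<le> 9 * (48 * \<delta>)"
    using slope_near(1)[OF yp] slope_near(2)[OF ym] small by (intro slope_angle_near_one) auto
  ultimately show ?thesis by simp
qed

end

subsection \<open>Asymptotics of the monodromy matrix\<close>

text \<open>Returns from p and r to the entries of the monodromy matrix: in the limit p contributes
  1 and i in the two columns and r contributes 0, which is the limit matrix.\<close>

lemma monodromy_near_limit:
  assumes "m \<ge> 0" "a > 0" and q: "locally_integrable q" and \<Phi>: "fundamental_solution m q \<Phi>"
  obtains C \<alpha>\<^sub>0 where "C > 0" "\<alpha>\<^sub>0 > 0"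
    "\<And>z. Im z \<ge> \<alpha>\<^sub>0 \<Longrightarrow> near_limit (exp (\<i> * (z * of_real a - of_real (potential_integral q a))) *\<^sub>M \<Phi> a z) (C / Im z)"
proof -
  define C where "C = (m + 3 * m\<^sup>2 * a) / 2 + (1 / a + 3 * m) / 2"
  \<comment> \<open>Collects the thresholds m and m^2 a of the integral estimate and the 100 C that
    brings C / Im z below 1 / 100.\<close>
  define \<alpha>\<^sub>0 where "\<alpha>\<^sub>0 = 1 + m + m\<^sup>2 * a + 100 * C"
  have "1 / a > 0" and nn: "m\<^sup>2 * a \<ge> 0" and "3 * m\<^sup>2 * a \<ge> 0" using assms(2) by simp_all
  then have "C > 0" using assms(1) unfolding C_def by argo
  then have "\<alpha>\<^sub>0 > 0" using assms(1) nn unfolding \<alpha>\<^sub>0_def by linarith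
  show thesis
  proof (rule that[OF \<open>C > 0\<close> \<open>\<alpha>\<^sub>0 > 0\<close>])
    fix z assume z: "Im z \<ge> \<alpha>\<^sub>0"
    have z0: "0 < Im z" and z1: "m \<le> Im z" and z2: "m\<^sup>2 * a \<le> Im z" and z3: "100 * C \<le> Im z"
      using z \<open>C > 0\<close> assms(1) nn by (simp_all add: \<alpha>\<^sub>0_def)
    define e where "e = exp (\<i> * phase q z a)"
    have e: "exp (\<i> * (z * of_real a - of_real (potential_integral q a))) = e"
      using \<open>a > 0\<close> by (simp add: e_def phase_def potential_integral_def)
    have sol: "dirac_solution m q z (\<lambda>x. \<Phi> x z)" and init: "\<Phi> 0 z = mat 1"
      using \<Phi> by (auto simp: fundamental_solution_def)
    define p where "p j = e * (\<Phi> a z $ 1 $ j + \<i> * \<Phi> a z $ 2 $ j)" for j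
    define r where "r j = e * (\<Phi> a z $ 1 $ j - \<i> * \<Phi> a z $ 2 $ j)" for j
    note b = dirac_column_bound[OF assms(1,2) q sol z0 z1 z2 init, folded e_def]
    have half: "norm (c * (x + y)) \<le> C / Im z" "norm (c * (x - y)) \<le> C / Im z"
      if "norm x \<le> (m + 3 * m\<^sup>2 * a) / (2 * Im z)" "norm y \<le> (1 / a + 3 * m) / (2 * Im z)" "norm c = 1 / 2" for c x y :: complex
    proof -
      have "(m + 3 * m\<^sup>2 * a) / (2 * Im z) + (1 / a + 3 * m) / (2 * Im z) = C / Im z"
        using z0 by (simp add: C_def add_divide_distrib)
      then have "norm (x + y) \<le> C / Im z" "norm (x - y) \<le> C / Im z"
        using that norm_triangle_ineq[of x y] norm_triangle_ineq4[of x y] by linarith+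
      moreover have "0 \<le> C / Im z" using \<open>C > 0\<close> z0 by simp
      ultimately show "norm (c * (x + y)) \<le> C / Im z" "norm (c * (x - y)) \<le> C / Im z"
        unfolding norm_mult that(3) by linarith+
    qed
    have p1: "norm (p 1 - 1) \<le> (m + 3 * m\<^sup>2 * a) / (2 * Im z)" and p2: "norm (p 2 - \<i>) \<le> (m + 3 * m\<^sup>2 * a) / (2 * Im z)"
      using b(1)[of 1] b(1)[of 2] by (simp_all add: p_def mat_def)
    have r: "norm (r j) \<le> (1 / a + 3 * m) / (2 * Im z)" for j using b(2) by (simp add: r_def)
    \<comment> \<open>u1 = (p + r) / 2 and u2 = -i (p - r) / 2, with the limits subtracted.\<close>
    have "e * \<Phi> a z $ 1 $ 1 - 1 / 2 = 1 / 2 * ((p 1 - 1) + r 1)"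
      "e * \<Phi> a z $ 1 $ 2 - \<i> / 2 = 1 / 2 * ((p 2 - \<i>) + r 2)"
      "e * \<Phi> a z $ 2 $ 1 - (- \<i> / 2) = (- \<i> / 2) * ((p 1 - 1) - r 1)"
      "e * \<Phi> a z $ 2 $ 2 - 1 / 2 = (- \<i> / 2) * ((p 2 - \<i>) - r 2)"
      by (simp_all add: p_def r_def algebra_simps)
    then have entries: "norm (e * \<Phi> a z $ 1 $ 1 - 1 / 2) \<le> C / Im z"
      "norm (e * \<Phi> a z $ 1 $ 2 - \<i> / 2) \<le> C / Im z"
      "norm (e * \<Phi> a z $ 2 $ 1 - (- \<i> / 2)) \<le> C / Im z"
      "norm (e * \<Phi> a z $ 2 $ 2 - 1 / 2) \<le> C / Im z"
      using half[OF p1 r, of "1 / 2"] half[OF p1 r, of "- \<i> / 2"] half[OF p2 r, of "1 / 2"] half[OF p2 r, of "- \<i> / 2"]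
      by (simp_all only: norm_divide norm_minus_cancel norm_one norm_ii norm_numeral simp_thms)
    show "near_limit (exp (\<i> * (z * of_real a - of_real (potential_integral q a))) *\<^sub>M \<Phi> a z) (C / Im z)"
      unfolding e
    proof
      fix i j
      show "norm ((e *\<^sub>M \<Phi> a z) $ i $ j - limit_matrix $ i $ j) \<le> C / Im z"
        using exhaust_2[of i] exhaust_2[of j] entries
        by (elim disjE) (simp_all only: cscale_nth[of e] limit_matrix_nth)
      show "C / Im z \<le> 1 / 100" using z3 z0 by (simp add: field_simps)
    qed
  qed
qed

section \<open>From bounds on a half-plane to the asymptotics\<close>

lemma bigo_inverseI:
  fixes f :: "real \<Rightarrow> real"
  assumes "\<And>\<alpha>. \<alpha> \<ge> \<beta> \<Longrightarrow> \<bar>f \<alpha>\<bar> \<le> K / \<alpha>"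
  shows "f \<in> O[at_top](\<lambda>\<alpha>. 1 / \<alpha>)"
proof (rule bigoI[of _ K])
  show "\<forall>\<^sub>F \<alpha> in at_top. norm (f \<alpha>) \<le> K * norm (1 / \<alpha>)"
    using eventually_ge_at_top[of \<beta>] eventually_gt_at_top[of 0]
    by eventually_elim (use assms in simp)
qed

lemma norm_mat2_le:
  fixes A :: "complex^2^2"
  assumes "\<And>i j. norm (A $ i $ j) \<le> b"
  shows "norm A \<le> 4 * b"
  using norm_vec2_le[of A] norm_vec2_le[of "A $ 1"] norm_vec2_le[of "A $ 2"]
    assms[of 1 1] assms[of 1 2] assms[of 2 1] assms[of 2 2] by linarith

locale monodromy_asymptotics =
  fixes \<Phi> :: "real \<Rightarrow> complex \<Rightarrow> complex^2^2" and a Q C \<alpha>\<^sub>0 :: real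
  assumes a_pos: "a > 0" and C_pos: "C > 0" and \<alpha>\<^sub>0_pos: "\<alpha>\<^sub>0 > 0"
    and near_limit: "Im z \<ge> \<alpha>\<^sub>0 \<Longrightarrow>
      near_limit (exp (\<i> * (z * of_real a - of_real Q)) *\<^sub>M monodromy \<Phi> a z) (C / Im z)"
begin

definition factor :: "complex \<Rightarrow> complex" where
  "factor z = exp (\<i> * (z * of_real a - of_real Q))"

lemmas near_factor = near_limit[folded factor_def]

lemma factor_nonzero: "factor z \<noteq> 0" by (simp add: factor_def)

lemma norm_factor: "norm (factor z) = exp (- (Im z * a))"
  by (simp add: factor_def)

text \<open>Exponential decay is weakened to the order 1 / Im z of the other errors.\<close>

lemma norm_factor_le:
  assumes "Im z > 0" shows "norm (factor z) \<le> (1 / a) / Im z"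
proof -
  have "Im z * a \<le> exp (Im z * a)" using exp_ge_add_one_self[of "Im z * a"] by linarith
  then show ?thesis using assms a_pos by (simp add: norm_factor exp_minus field_simps)
qed

lemma scaled_discriminant:
  assumes "Im z \<ge> \<alpha>\<^sub>0"
  shows "norm (factor z * discriminant \<Phi> a z - 1) \<le> 2 * C / Im z"
  using near_limit.trace_near[OF near_factor[OF assms]]
  by (simp add: discriminant_def trace_def sum_2 algebra_simps)

text \<open>Relates the scaling exp (-\<alpha> a) of the assertions to \<open>factor\<close>; the
  quotient has modulus 1, so norms of errors carry over unchanged.\<close>

lemma factor_phase:
  "exp (- \<alpha> * a) = exp (\<i> * complex_of_real (Q - \<mu> * a)) * factor (Complex \<mu> \<alpha>)"
proof -
  have "\<i> * complex_of_real (Q - \<mu> * a) + \<i> * (Complex \<mu> \<alpha> * of_real a - of_real Q) = of_real (- \<alpha> * a)"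
    by (simp add: complex_eq_iff algebra_simps)
  then show ?thesis unfolding factor_def exp_add[symmetric] by (simp only: exp_of_real)
qed

lemma norm_phase: "norm (exp (\<i> * complex_of_real x)) = 1"
  by simp

lemma monodromy_bound:
  assumes "\<alpha> \<ge> \<alpha>\<^sub>0"
  shows "norm (exp (- \<alpha> * a) *\<^sub>R monodromy \<Phi> a (Complex \<mu> \<alpha>)
      - (1 / 2 * exp (\<i> * complex_of_real (Q - \<mu> * a))) *\<^sub>M (mat 1 - \<sigma>2)) \<le> 4 * (C / \<alpha>)"
proof (rule norm_mat2_le)
  fix i j
  let ?w = "exp (\<i> * complex_of_real (Q - \<mu> * a))" and ?z = "Complex \<mu> \<alpha>"
  have "(exp (- \<alpha> * a) *\<^sub>R monodromy \<Phi> a ?z - (1 / 2 * ?w) *\<^sub>M (mat 1 - \<sigma>2)) $ i $ j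
      = exp (- \<alpha> * a) * monodromy \<Phi> a ?z $ i $ j - (1 / 2 * ?w) * (mat 1 - \<sigma>2) $ i $ j"
    by (simp only: vector_minus_component vector_scaleR_component cscale_nth) (simp only: scaleR_conv_of_real)
  also have "\<dots> = ?w * ((factor ?z *\<^sub>M monodromy \<Phi> a ?z) $ i $ j - limit_matrix $ i $ j)"
    unfolding factor_phase[of \<alpha> \<mu>]
    by (simp only: cscale_nth right_diff_distrib mult.assoc mult.commute mult.left_commute)
  also have "norm \<dots> \<le> C / \<alpha>"
    unfolding norm_mult norm_phase using near_limit.near[OF near_factor[of ?z]] assms by simp
  finally show "norm ((exp (- \<alpha> * a) *\<^sub>R monodromy \<Phi> a ?z - (1 / 2 * ?w) *\<^sub>M (mat 1 - \<sigma>2)) $ i $ j) \<le> C / \<alpha>" .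
qed

lemma discriminant_bound:
  assumes "\<alpha> \<ge> \<alpha>\<^sub>0"
  shows "norm (exp (- \<alpha> * a) *\<^sub>R discriminant \<Phi> a (Complex \<mu> \<alpha>)
      - exp (\<i> * complex_of_real (Q - \<mu> * a))) \<le> 2 * C / \<alpha>"
proof -
  let ?w = "exp (\<i> * complex_of_real (Q - \<mu> * a))" and ?z = "Complex \<mu> \<alpha>"
  have "exp (- \<alpha> * a) *\<^sub>R discriminant \<Phi> a ?z - ?w = ?w * (factor ?z * discriminant \<Phi> a ?z - 1)"
    unfolding scaleR_conv_of_real factor_phase[of \<alpha> \<mu>] by (simp add: algebra_simps)
  then show ?thesis
    unfolding norm_mult norm_phase using scaled_discriminant[of ?z] assms by (simp add: norm_mult)
qed

text \<open>The discriminant is the sum of both multipliers. The one of modulus at most 1 is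
  suppressed by \<open>factor\<close>, so the other carries the whole scaled trace 1 + O(1 / Im
  z).\<close>

lemma scaled_multipliers:
  assumes k: "quasimomentum \<Phi> a k" and z: "Im z \<ge> \<alpha>\<^sub>0"
  shows "norm (factor z * exp (\<i> * k z * of_real a)) \<le> (2 * C + 1 / a) / Im z"
    and "norm (factor z * exp (- \<i> * k z * of_real a) - 1) \<le> (2 * C + 1 / a) / Im z"
proof -
  have z0: "Im z > 0" using z \<alpha>\<^sub>0_pos by linarith
  have D: "discriminant \<Phi> a z = 2 * cos (k z * of_real a)" and "Im (k z) \<ge> 0"
    using k z0 by (auto simp: quasimomentum_def)
  then have "norm (exp (\<i> * k z * of_real a)) \<le> 1" using a_pos by simp
  then have "norm (factor z * exp (\<i> * k z * of_real a)) \<le> norm (factor z) * 1"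
    unfolding norm_mult by (rule mult_left_mono) simp
  with norm_factor_le[OF z0]
  have small: "norm (factor z * exp (\<i> * k z * of_real a)) \<le> (1 / a) / Im z" by simp
  have "2 * C / Im z \<ge> 0" using C_pos z0 by simp
  with small show "norm (factor z * exp (\<i> * k z * of_real a)) \<le> (2 * C + 1 / a) / Im z"
    by (simp add: add_divide_distrib)
  have "factor z * exp (- \<i> * k z * of_real a) - 1
      = (factor z * discriminant \<Phi> a z - 1) - factor z * exp (\<i> * k z * of_real a)"
    unfolding D cos_exp_eq by (simp add: algebra_simps)
  also have "norm \<dots> \<le> 2 * C / Im z + (1 / a) / Im z"
    by (rule order_trans[OF norm_triangle_ineq4 add_mono[OF scaled_discriminant[OF z] small]])
  finally show "norm (factor z * exp (- \<i> * k z * of_real a) - 1) \<le> (2 * C + 1 / a) / Im z"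
    by (simp add: add_divide_distrib)
qed

text \<open>
  The difference of \<open>k\<close> and the logarithm of the multiplier is continuous on a half-plane and
  takes values in \<open>2 \<pi> \<int> / a\<close>, hence it is constant there.
\<close>
lemma quasimomentum_bound:
  assumes k: "quasimomentum \<Phi> a k"
  obtains n :: int and \<beta> K :: real where
    "\<And>z. Im z \<ge> \<beta> \<Longrightarrow>
      norm ((k z + of_real (2 * pi / a * of_int n)) - (z - of_real (Q / a))) \<le> K / Im z"
proof -
  define C' where "C' = 2 * C + 1 / a"
  have C': "C' > 0" using C_pos a_pos by (simp add: C'_def add_pos_pos)
  \<comment> \<open>The term 2 C' keeps \<open>\<zeta>\<close> within 1/2 of 1, away from the branch
    cut of the logarithm.\<close>
  define \<beta> where "\<beta> = \<alpha>\<^sub>0 + 2 * C' + 1"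
  define S where "S = {z. Im z \<ge> \<beta>}"
  define \<zeta> where "\<zeta> z = factor z * exp (- \<i> * k z * of_real a)" for z
  \<comment> \<open>Since \<zeta> = exp (i (z a - Q - k a)), a logarithm of \<zeta> times i / a is k
    - z + Q / a up to a multiple of 2 pi / a; \<open>g\<close> is that multiple.\<close>
  define g where "g z = k z - z + of_real (Q / a) - \<i> / of_real a * Ln (\<zeta> z)" for z
  have \<zeta>: "norm (\<zeta> z - 1) \<le> C' / Im z" "C' / Im z < 1 / 2" if "z \<in> S" for z
  proof -
    have "Im z \<ge> \<alpha>\<^sub>0" "Im z > 2 * C'" using that C' \<alpha>\<^sub>0_pos by (auto simp: S_def \<beta>_def)
    then show "norm (\<zeta> z - 1) \<le> C' / Im z"
      unfolding \<zeta>_def C'_def by (intro scaled_multipliers(2)[OF k])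
    show "C' / Im z < 1 / 2" using \<open>Im z > 2 * C'\<close> C' by (simp add: field_simps)
  qed
  have \<zeta>0: "\<zeta> z \<noteq> 0" for z by (simp add: \<zeta>_def factor_nonzero)
  have g_values: "\<exists>n::int. g z = of_real (2 * pi / a * of_int n)" for z
  proof -
    have "exp (\<i> * of_real a * g z) = exp (Ln (\<zeta> z) - (\<i> * (z * of_real a - of_real Q) + - \<i> * k z * of_real a))"
      using a_pos by (intro arg_cong[of _ _ exp]) (simp add: g_def field_simps)
    also have "\<dots> = exp (Ln (\<zeta> z)) / \<zeta> z"
      by (simp only: exp_diff exp_add \<zeta>_def factor_def)
    also have "\<dots> = 1" using \<zeta>0[of z] by simp
    finally obtain n :: int where n: "a * Im (g z) = 0" "a * Re (g z) = of_int (2 * n) * pi"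
      unfolding exp_eq_1 by auto
    then show ?thesis
      using a_pos by (intro exI[of _ n]) (simp add: complex_eq_iff field_simps)
  qed
  have "g constant_on S"
  proof (rule continuous_discrete_range_constant)
    show "connected S" unfolding S_def by (intro convex_connected convex_halfspace_Im_ge)
    have S: "S \<subseteq> {z. 0 \<le> Im z}" using C' \<alpha>\<^sub>0_pos by (auto simp: S_def \<beta>_def)
    have ck: "continuous_on S k"
      using k continuous_on_subset[OF _ S] by (auto simp: quasimomentum_def)
    have "\<zeta> z \<notin> \<real>\<^sub>\<le>\<^sub>0" if "z \<in> S" for z
    proof -
      have "\<bar>Re (\<zeta> z - 1)\<bar> < 1" using \<zeta>[OF that] abs_Re_le_cmod[of "\<zeta> z - 1"] by linarith
      then show ?thesis by (auto simp: complex_nonpos_Reals_iff)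
    qed
    moreover have "continuous_on S \<zeta>"
      unfolding \<zeta>_def[abs_def] factor_def[abs_def] by (intro continuous_intros ck)
    ultimately have cLn: "continuous_on S (\<lambda>z. Ln (\<zeta> z))" by (intro continuous_on_Ln') auto
    show "continuous_on S g"
      unfolding g_def[abs_def]
      by (intro continuous_on_diff continuous_on_add continuous_on_mult continuous_on_const continuous_on_id ck cLn)
    fix x assume "x \<in> S"
    show "\<exists>e>0. \<forall>y. y \<in> S \<and> g y \<noteq> g x \<longrightarrow> e \<le> norm (g y - g x)"
    proof (intro exI[of _ "2 * pi / a"] conjI allI impI)
      show "2 * pi / a > 0" using a_pos by simp
      fix y assume y: "y \<in> S \<and> g y \<noteq> g x"
      obtain i j :: int where ij: "g y = of_real (2 * pi / a * of_int i)" "g x = of_real (2 * pi / a * of_int j)"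
        using g_values[of x] g_values[of y] by auto
      then have "i \<noteq> j" using y by auto
      then have "1 \<le> \<bar>real_of_int (i - j)\<bar>" by linarith
      have "norm (g y - g x) = norm (complex_of_real (2 * pi / a * of_int (i - j)))"
        by (simp only: ij of_int_diff right_diff_distrib of_real_diff)
      also have "\<dots> = 2 * pi / a * \<bar>real_of_int (i - j)\<bar>"
        using a_pos by (simp only: norm_of_real abs_mult) simp
      also have "\<dots> \<ge> 2 * pi / a * 1"
        using a_pos \<open>1 \<le> _\<close> by (intro mult_left_mono) auto
      finally show "2 * pi / a \<le> norm (g y - g x)" by simp
    qed
  qed
  then obtain c where c: "\<And>z. z \<in> S \<Longrightarrow> g z = c" by (auto simp: constant_on_def)
  have "Complex 0 \<beta> \<in> S" by (simp add: S_def)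
  with c g_values obtain n :: int where n: "c = of_real (2 * pi / a * of_int n)" by metis
  show thesis
  \<comment> \<open>The constant value of \<open>g\<close> is subtracted, hence the sign of the
    integer; the 2 stems from |Ln (1 + w)| \<le> 2 |w| for |w| < 1/2.\<close>
  proof (rule that[of \<beta> "- n" "2 * C' / a"])
    fix z assume "Im z \<ge> \<beta>"
    then have z: "z \<in> S" by (simp add: S_def)
    have "(k z + of_real (2 * pi / a * of_int (- n))) - (z - of_real (Q / a)) = \<i> / of_real a * Ln (1 + (\<zeta> z - 1))"
      using c[OF z] by (simp add: n g_def algebra_simps)
    also have "norm \<dots> = norm (Ln (1 + (\<zeta> z - 1))) / a"
      using a_pos by (simp add: norm_mult norm_divide)
    also have "\<dots> \<le> 2 * norm (\<zeta> z - 1) / a"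
      using a_pos le_less_trans[OF \<zeta>[OF z]] by (intro divide_right_mono norm_Ln_le) auto
    also have "\<dots> \<le> 2 * (C' / Im z) / a"
      using a_pos \<zeta>(1)[OF z] by (intro divide_right_mono mult_left_mono) auto
    finally show "norm ((k z + of_real (2 * pi / a * of_int (- n))) - (z - of_real (Q / a))) \<le> 2 * C' / a / Im z"
      by (simp add: mult.commute)
  qed
qed

text \<open>Eigenvectors are prescribed only off the band. There Im z \<ge> 4 / a gives |factor z|
  \<le> 1/4, so a discriminant in [-2, 2] would scale to modulus at most 1/2, although the scaled
  value is within 1/50 of 1.\<close>

lemma discriminant_outside_band:
  assumes z: "Im z \<ge> \<alpha>\<^sub>0" "Im z \<ge> 4 / a"
  shows "discriminant \<Phi> a z \<notin> complex_of_real ` {-2..2}"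
proof
  assume "discriminant \<Phi> a z \<in> complex_of_real ` {-2..2}"
  then have D: "norm (discriminant \<Phi> a z) \<le> 2" by auto
  have z0: "Im z > 0" using z \<alpha>\<^sub>0_pos by linarith
  have "(1 / a) / Im z \<le> 1 / 4" using z(2) a_pos z0 by (simp add: field_simps)
  with norm_factor_le[OF z0] have "norm (factor z) \<le> 1 / 4" by linarith
  then have "norm (factor z * discriminant \<Phi> a z) \<le> 1 / 4 * 2"
    unfolding norm_mult using D by (intro mult_mono) auto
  moreover have "norm (factor z * discriminant \<Phi> a z - 1) \<le> 1 / 50"
  proof -
    have "2 * C / Im z = 2 * (C / Im z)" by simp
    with scaled_discriminant[OF z(1)] near_limit.small[OF near_factor[OF z(1)]] show ?thesis by linarith
  qed
  ultimately show False
    using norm_triangle_ineq3[of 1 "factor z * discriminant \<Phi> a z"] by (simp add: norm_minus_commute)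
qed

text \<open>The eigenvectors also belong to the scaled matrix, with eigenvalues near 1 and 0, so
  dividing by the first component leaves only the error of the slope.\<close>

lemma eigenvector_bound:
  assumes k: "quasimomentum \<Phi> a k" and v: "monodromy_eigenvectors \<Phi> a k v\<^sub>p v\<^sub>m"
    and z: "Im z \<ge> \<alpha>\<^sub>0" "Im z \<ge> 4 / a"
  shows "v\<^sub>p z $ 1 \<noteq> 0" "v\<^sub>m z $ 1 \<noteq> 0"
    and "norm ((1 / v\<^sub>p z $ 1) *s v\<^sub>p z - vector [1, - \<i>]) \<le> 4 * (4 * C + 1 / a) / Im z"
    and "norm ((1 / v\<^sub>m z $ 1) *s v\<^sub>m z - vector [1, \<i>]) \<le> 4 * (4 * C + 1 / a) / Im z"
proof -
  have z0: "Im z \<ge> 0" using z \<alpha>\<^sub>0_pos by linarith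
  have "eigenvector_for (monodromy \<Phi> a z) (exp (-\<i> * k z * of_real a)) (v\<^sub>p z)"
    "eigenvector_for (monodromy \<Phi> a z) (exp (\<i> * k z * of_real a)) (v\<^sub>m z)"
    using v z0 discriminant_outside_band[OF z] unfolding monodromy_eigenvectors_def by blast+
  note e = this[THEN eigenvector_for_cscale[where c = "factor z"]]
  interpret near_limit "factor z *\<^sub>M monodromy \<Phi> a z" "C / Im z" by (rule near_factor[OF z(1)])
  show "v\<^sub>p z $ 1 \<noteq> 0" "v\<^sub>m z $ 1 \<noteq> 0" using normalised_eigenvector(1) e by blast+
  have eq: "4 * ((2 * C + 1 / a) / Im z + 2 * (C / Im z)) = 4 * (4 * C + 1 / a) / Im z"
    by (simp add: add_divide_distrib)
  show "norm ((1 / v\<^sub>p z $ 1) *s v\<^sub>p z - vector [1, - \<i>]) \<le> 4 * (4 * C + 1 / a) / Im z"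
    using normalised_eigenvector(2)[OF e(1) scaled_multipliers(2)[OF k z(1)]] unfolding eq .
  show "norm ((1 / v\<^sub>m z $ 1) *s v\<^sub>m z - vector [1, \<i>]) \<le> 4 * (4 * C + 1 / a) / Im z"
    using normalised_eigenvector(3)[OF e(2) scaled_multipliers(1)[OF k z(1)]] unfolding eq .
qed

lemma angle_bound:
  assumes "Im z \<ge> \<alpha>\<^sub>0"
  shows "\<bar>eigenvector_angle (monodromy \<Phi> a z) - 1\<bar> \<le> 432 * C / Im z"
  using near_limit.eigenvector_angle_near[OF near_factor[OF assms]]
  by (simp add: eigenvector_angle_cscale factor_nonzero)

end

theorem theorem8:
  fixes m a :: real and q :: "real \<Rightarrow> real" and \<Phi> :: "real \<Rightarrow> complex \<Rightarrow> complex^2^2"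
  assumes "m \<ge> 0" and "a > 0"
    and "locally_integrable q" and "\<forall>x. q (x + a) = q x"
    and "fundamental_solution m q \<Phi>"
  shows
    "(\<forall>\<mu>::real. (\<lambda>\<alpha>. norm (exp (-\<alpha> * a) *\<^sub>R monodromy \<Phi> a (Complex \<mu> \<alpha>)
          - (1/2 * exp (\<i> * complex_of_real (potential_integral q a - \<mu> * a))) *\<^sub>M (mat 1 - \<sigma>2)))
        \<in> O[at_top](\<lambda>\<alpha>::real. 1 / \<alpha>)) \<and>
     (\<forall>\<mu>::real. (\<lambda>\<alpha>. norm (exp (-\<alpha> * a) *\<^sub>R discriminant \<Phi> a (Complex \<mu> \<alpha>)
          - exp (\<i> * complex_of_real (potential_integral q a - \<mu> * a))))
        \<in> O[at_top](\<lambda>\<alpha>::real. 1 / \<alpha>)) \<and>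
     (\<forall>k. quasimomentum \<Phi> a k \<longrightarrow>
        (\<exists>n::int. \<forall>\<mu>::real.
          (\<lambda>\<alpha>. norm ((k (Complex \<mu> \<alpha>) + complex_of_real (2 * pi / a * of_int n))
             - (Complex \<mu> \<alpha> - complex_of_real (potential_integral q a / a))))
          \<in> O[at_top](\<lambda>\<alpha>::real. 1 / \<alpha>))) \<and>
     (\<forall>k v\<^sub>p v\<^sub>m. quasimomentum \<Phi> a k \<longrightarrow> monodromy_eigenvectors \<Phi> a k v\<^sub>p v\<^sub>m \<longrightarrow>
        (\<exists>c\<^sub>p c\<^sub>m :: complex \<Rightarrow> complex. (\<forall>z. c\<^sub>p z \<noteq> 0 \<and> c\<^sub>m z \<noteq> 0) \<and>
          (\<forall>\<mu>::real.
            (\<lambda>\<alpha>. norm (c\<^sub>p (Complex \<mu> \<alpha>) *s v\<^sub>p (Complex \<mu> \<alpha>) - vector [1, -\<i>]))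
              \<in> O[at_top](\<lambda>\<alpha>::real. 1 / \<alpha>) \<and>
            (\<lambda>\<alpha>. norm (c\<^sub>m (Complex \<mu> \<alpha>) *s v\<^sub>m (Complex \<mu> \<alpha>) - vector [1, \<i>]))
              \<in> O[at_top](\<lambda>\<alpha>::real. 1 / \<alpha>)))) \<and>
     (\<forall>\<mu>::real. (\<lambda>\<alpha>. eigenvector_angle (monodromy \<Phi> a (Complex \<mu> \<alpha>)) - 1)
        \<in> O[at_top](\<lambda>\<alpha>::real. 1 / \<alpha>))"
proof -
  obtain C \<alpha>\<^sub>0 where C: "C > 0" "\<alpha>\<^sub>0 > 0" "\<And>z. Im z \<ge> \<alpha>\<^sub>0 \<Longrightarrow>
      near_limit (exp (\<i> * (z * of_real a - of_real (potential_integral q a))) *\<^sub>M \<Phi> a z) (C / Im z)"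
    by (rule monodromy_near_limit[OF assms(1-3,5)]) blast
  interpret monodromy_asymptotics \<Phi> a "potential_integral q a" C \<alpha>\<^sub>0
    by (rule monodromy_asymptotics.intro) (use C assms(2) in \<open>simp_all add: monodromy_def\<close>)
  show ?thesis
  proof (intro conjI allI impI)
    fix \<mu> :: real
    show "(\<lambda>\<alpha>. norm (exp (-\<alpha> * a) *\<^sub>R monodromy \<Phi> a (Complex \<mu> \<alpha>)
          - (1/2 * exp (\<i> * complex_of_real (potential_integral q a - \<mu> * a))) *\<^sub>M (mat 1 - \<sigma>2)))
        \<in> O[at_top](\<lambda>\<alpha>::real. 1 / \<alpha>)"
      by (rule bigo_inverseI[of \<alpha>\<^sub>0 _ "4 * C"]) (use monodromy_bound in simp)
    show "(\<lambda>\<alpha>. norm (exp (-\<alpha> * a) *\<^sub>R discriminant \<Phi> a (Complex \<mu> \<alpha>)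
          - exp (\<i> * complex_of_real (potential_integral q a - \<mu> * a))))
        \<in> O[at_top](\<lambda>\<alpha>::real. 1 / \<alpha>)"
      by (rule bigo_inverseI[of \<alpha>\<^sub>0 _ "2 * C"]) (use discriminant_bound in simp)
    show "(\<lambda>\<alpha>. eigenvector_angle (monodromy \<Phi> a (Complex \<mu> \<alpha>)) - 1) \<in> O[at_top](\<lambda>\<alpha>::real. 1 / \<alpha>)"
      by (rule bigo_inverseI[of \<alpha>\<^sub>0 _ "432 * C"]) (use angle_bound[of "Complex \<mu> _"] in simp)
  next
    fix k assume "quasimomentum \<Phi> a k"
    then obtain n :: int and \<beta> K :: real where *: "\<And>z. Im z \<ge> \<beta> \<Longrightarrow>
      norm ((k z + of_real (2 * pi / a * of_int n)) - (z - of_real (potential_integral q a / a))) \<le> K / Im z"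
      using quasimomentum_bound by blast
    show "\<exists>n::int. \<forall>\<mu>::real.
          (\<lambda>\<alpha>. norm ((k (Complex \<mu> \<alpha>) + complex_of_real (2 * pi / a * of_int n))
             - (Complex \<mu> \<alpha> - complex_of_real (potential_integral q a / a))))
          \<in> O[at_top](\<lambda>\<alpha>::real. 1 / \<alpha>)"
    proof (intro exI[of _ n] allI bigo_inverseI[of \<beta> _ K])
      fix \<mu> \<alpha> :: real assume "\<alpha> \<ge> \<beta>"
      with *[of "Complex \<mu> \<alpha>"]
      show "\<bar>norm ((k (Complex \<mu> \<alpha>) + complex_of_real (2 * pi / a * of_int n))
             - (Complex \<mu> \<alpha> - complex_of_real (potential_integral q a / a)))\<bar> \<le> K / \<alpha>"
        by simp
    qed
  next
    fix k v\<^sub>p v\<^sub>m assume k: "quasimomentum \<Phi> a k" and v: "monodromy_eigenvectors \<Phi> a k v\<^sub>p v\<^sub>m"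
    \<comment> \<open>The default 1 keeps the normalising factor nonzero at all z, also where the
      first component vanishes or the eigenvectors are not prescribed.\<close>
    define c :: "complex^2 \<Rightarrow> complex" where "c w = (if w $ 1 = 0 then 1 else 1 / w $ 1)" for w
    define \<beta> where "\<beta> = max \<alpha>\<^sub>0 (4 / a)"
    define K where "K = 4 * (4 * C + 1 / a)"
    have bound: "norm (c (v\<^sub>p z) *s v\<^sub>p z - vector [1, - \<i>]) \<le> K / Im z"
      "norm (c (v\<^sub>m z) *s v\<^sub>m z - vector [1, \<i>]) \<le> K / Im z" if "Im z \<ge> \<beta>" for z
      using eigenvector_bound[OF k v, of z] that by (simp_all add: c_def \<beta>_def K_def)
    show "\<exists>c\<^sub>p c\<^sub>m :: complex \<Rightarrow> complex. (\<forall>z. c\<^sub>p z \<noteq> 0 \<and> c\<^sub>m z \<noteq> 0) \<and>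
          (\<forall>\<mu>::real.
            (\<lambda>\<alpha>. norm (c\<^sub>p (Complex \<mu> \<alpha>) *s v\<^sub>p (Complex \<mu> \<alpha>) - vector [1, -\<i>]))
              \<in> O[at_top](\<lambda>\<alpha>::real. 1 / \<alpha>) \<and>
            (\<lambda>\<alpha>. norm (c\<^sub>m (Complex \<mu> \<alpha>) *s v\<^sub>m (Complex \<mu> \<alpha>) - vector [1, \<i>]))
              \<in> O[at_top](\<lambda>\<alpha>::real. 1 / \<alpha>))"
    proof (rule exI[of _ "\<lambda>z. c (v\<^sub>p z)"], rule exI[of _ "\<lambda>z. c (v\<^sub>m z)"], intro conjI allI)
      fix \<mu> :: real
      show "(\<lambda>\<alpha>. norm (c (v\<^sub>p (Complex \<mu> \<alpha>)) *s v\<^sub>p (Complex \<mu> \<alpha>) - vector [1, -\<i>])) \<in> O[at_top](\<lambda>\<alpha>. 1 / \<alpha>)"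
        by (rule bigo_inverseI[of \<beta> _ K]) (use bound(1)[of "Complex \<mu> _"] in simp)
      show "(\<lambda>\<alpha>. norm (c (v\<^sub>m (Complex \<mu> \<alpha>)) *s v\<^sub>m (Complex \<mu> \<alpha>) - vector [1, \<i>])) \<in> O[at_top](\<lambda>\<alpha>. 1 / \<alpha>)"
        by (rule bigo_inverseI[of \<beta> _ K]) (use bound(2)[of "Complex \<mu> _"] in simp)
    qed (simp_all add: c_def)
  qed
qed

end
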